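(* Let $V$ be a universe of $\mathsf{ZFA}$ whose atoms form a set $A$, let $\mathcal{G}$ be a group of permutations of $A$, let $\mathcal{F}$ be a normal filter of subgroups of $\mathcal{G}$, and let $\mathsf{HS}$ be the permutation model obtained from $\mathcal{G}$ and $\mathcal{F}$. Let $\kappa$ be an infinite cardinal. Assuming $\mathsf{DC}_\kappa$ holds in $V$, if $\mathcal{F}$ is $(\kappa+1)$-shift complete, then $\mathsf{DC}_\kappa$ holds in $\mathsf{HS}$.
   Context: $\mathsf{ZFA}$ is $\mathsf{ZF}$ modified to allow atoms; the atoms are assumed to form a set $A$. Every permutation $\pi$ of $A$ extends recursively to the whole universe $V$ by $\pi(x)=\{\pi(y): y\in x\}$. Let $\mathcal{G}$ be a group of permutations of $A$. A filter of subgroups of $\mathcal{G}$ is a non-empty set $\mathcal{F}$ of subgroups of $\mathcal{G}$ closed under supergroups (that are subgroups of $\mathcal{G}$) and finite intersections. It is normal if $\pi H\pi^{-1}\in\mathcal{F}$ for all $H\in\mathcal{F}$ and $\pi\in\mathcal{G}$. For a set or atom $x$, $\mathrm{sym}(x)=\{\pi\in\mathcal{G}:\pi(x)=x\}$. Given a normal filter $\mathcal{F}$, $x$ is symmetric if $\mathrm{sym}(x)\in\mathcal{F}$, and hereditarily symmetric if $x$ and every element of the transitive closure of $x$ are symmetric. $\mathsf{HS}$ is the class of hereditarily symmetric objects; it is a transitive model of $\mathsf{ZFA}$, called the permutation model obtained from $\mathcal{G}$ and $\mathcal{F}$. For an infinite ordinal $\delta$, $\mathcal{F}$ is $\delta$-shift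 complete if for every $\gamma<\delta$ and every sequence $\langle H_\alpha:\alpha<\gamma\rangle$ of elements of $\mathcal{F}$ there are $\sigma_\alpha\in\mathcal{G}$ ($\alpha<\gamma$) such that, with $K_\alpha=\sigma_\alpha H_\alpha\sigma_\alpha^{-1}$: (1) $\bigcap_{\alpha<\gamma}K_\alpha\in\mathcal{F}$; and (2) for all $\alpha<\beta<\gamma$, $\sigma_\beta\sigma_\alpha^{-1}\in K_\alpha$. A tree is a partially ordered set in which the set of predecessors of each element is well-ordered. A tree $T$ is $\kappa$-closed if every chain in $T$ of order type $<\kappa$ has an upper bound in $T$. $\mathsf{DC}_\kappa$ is the statement: every $\kappa$-closed tree has a chain of order type $\kappa$ or a maximal element. *)

theory Defs
  imports "HOL-Algebra.Group"
begin

section \<open>The theory ZFA\<close>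

text \<open>A universe of ZFA is a model of first-order ZFA whose domain is a HOL type of class
  \<open>zfa\<close> (below). The membership relation need not be externally well-founded, and only
  the collections that the axioms provide are sets of the universe.\<close>

class zfa_signature =
  fixes mem :: "'a \<Rightarrow> 'a \<Rightarrow> bool" (infix "\<epsilon>" 50)
    and Atoms :: 'a

datatype fm = Mem nat nat | Eq nat nat | Neg fm | Conj fm fm | Ex nat fm

context zfa_signature
begin

text \<open>Everything that is not an atom is a set. The first argument \<open>M\<close> of a definition is the
  class over which its quantifiers range: \<open>UNIV\<close> for the universe itself, \<open>HS\<close> for
  the permutation model.\<close>

definition is_set :: "'a \<Rightarrow> bool" where
  "is_set x \<longleftrightarrow> \<not> x \<epsilon> Atoms"

definition elts_in :: "'a set \<Rightarrow> 'a \<Rightarrow> 'a set" where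
  "elts_in M x = {y \<in> M. y \<epsilon> x}"

abbreviation elts :: "'a \<Rightarrow> 'a set" where
  "elts \<equiv> elts_in UNIV"

text \<open>Satisfaction of first-order formulas in the universe. The variables of a formula are
  natural numbers; the values of the environment \<open>e\<close> serve as parameters, so that
  the constant for the set of atoms needs no symbol of its own.\<close>

primrec sat :: "(nat \<Rightarrow> 'a) \<Rightarrow> fm \<Rightarrow> bool" where
  "sat e (Mem i j) \<longleftrightarrow> e i \<epsilon> e j"
| "sat e (Eq i j) \<longleftrightarrow> e i = e j"
| "sat e (Neg p) \<longleftrightarrow> \<not> sat e p"
| "sat e (Conj p q) \<longleftrightarrow> sat e p \<and> sat e q"
| "sat e (Ex i p) \<longleftrightarrow> (\<exists>x. sat (e(i := x)) p)"

end

class zfa = zfa_signature +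
  assumes atoms: "x \<epsilon> Atoms \<Longrightarrow> elts x = {}"
    and extensionality: "is_set x \<Longrightarrow> is_set y \<Longrightarrow> elts x = elts y \<Longrightarrow> x = y"
    and foundation: "elts x \<noteq> {} \<Longrightarrow> \<exists>y\<in>elts x. elts y \<inter> elts x = {}"
    and pairing: "\<exists>z. is_set z \<and> elts z = {x, y}"
    and union: "\<exists>u. is_set u \<and> elts u = (\<Union>y\<in>elts x. elts y)"
    and power_set: "\<exists>p. is_set p \<and> elts p = {y. is_set y \<and> elts y \<subseteq> elts x}"
    and infinity: "\<exists>w. (\<exists>z\<in>elts w. is_set z \<and> elts z = {}) \<and>
                     (\<forall>n\<in>elts w. \<exists>s\<in>elts w. is_set s \<and> elts s = insert n (elts n))"
    and separation: "\<exists>y. is_set y \<and> elts y = {u \<in> elts x. sat (e(0 := u)) p}"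
    and replacement:
      "(\<forall>u\<in>elts x. \<forall>v v'. sat (e(0 := u, 1 := v)) p \<and> sat (e(0 := u, 1 := v')) p \<longrightarrow> v = v') \<Longrightarrow>
       \<exists>y. is_set y \<and> elts y = {v. \<exists>u\<in>elts x. sat (e(0 := u, 1 := v)) p}"


section \<open>Relations, functions and ordinals\<close>

definition is_upair :: "'v::zfa set \<Rightarrow> 'v \<Rightarrow> 'v \<Rightarrow> 'v \<Rightarrow> bool" where
  "is_upair M z x y \<longleftrightarrow> is_set z \<and> (\<forall>w\<in>M. w \<epsilon> z \<longleftrightarrow> w = x \<or> w = y)"

text \<open>Kuratowski pairs\<close>

definition is_pair :: "'v::zfa set \<Rightarrow> 'v \<Rightarrow> 'v \<Rightarrow> 'v \<Rightarrow> bool" where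
  "is_pair M p x y \<longleftrightarrow> (\<exists>s\<in>M. \<exists>d\<in>M. is_upair M s x x \<and> is_upair M d x y \<and> is_upair M p s d)"

definition rel :: "'v::zfa set \<Rightarrow> 'v \<Rightarrow> 'v \<Rightarrow> 'v \<Rightarrow> bool" where
  "rel M r x y \<longleftrightarrow> (\<exists>p\<in>M. is_pair M p x y \<and> p \<epsilon> r)"

definition is_function :: "'v::zfa set \<Rightarrow> 'v \<Rightarrow> 'v set \<Rightarrow> 'v set \<Rightarrow> bool" where
  "is_function M f X Y \<longleftrightarrow>
     is_set f \<and>
     (\<forall>p\<in>elts_in M f. \<exists>x\<in>X. \<exists>y\<in>Y. is_pair M p x y) \<and>
     (\<forall>x\<in>X. \<exists>!y. y \<in> M \<and> rel M f x y)"

definition app :: "'v::zfa set \<Rightarrow> 'v \<Rightarrow> 'v \<Rightarrow> 'v" where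
  "app M f x = (THE y. y \<in> M \<and> rel M f x y)"

definition is_bijection :: "'v::zfa set \<Rightarrow> 'v \<Rightarrow> 'v set \<Rightarrow> 'v set \<Rightarrow> bool" where
  "is_bijection M f X Y \<longleftrightarrow> is_function M f X Y \<and> bij_betw (app M f) X Y"

text \<open>Strict linear order in which every nonempty subset that belongs to \<open>M\<close> has a least
  element\<close>

definition well_ordered :: "'v::zfa set \<Rightarrow> 'v set \<Rightarrow> ('v \<Rightarrow> 'v \<Rightarrow> bool) \<Rightarrow> bool" where
  "well_ordered M X lt \<longleftrightarrow>
     irreflp_on X lt \<and> transp_on X lt \<and> totalp_on X lt \<and>
     (\<forall>Y\<in>M. is_set Y \<and> elts_in M Y \<subseteq> X \<and> elts_in M Y \<noteq> {} \<longrightarrow>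
        (\<exists>m\<in>elts_in M Y. \<forall>y\<in>elts_in M Y. y = m \<or> lt m y))"

text \<open>The members of an ordinal must be required to be sets: an atom has no members and would
  otherwise pass for the empty set.\<close>

definition ordinal :: "'v::zfa \<Rightarrow> bool" where
  "ordinal \<alpha> \<longleftrightarrow>
     is_set \<alpha> \<and> (\<forall>\<beta>\<in>elts \<alpha>. is_set \<beta> \<and> elts \<beta> \<subseteq> elts \<alpha>) \<and> well_ordered UNIV (elts \<alpha>) mem"

definition osucc :: "'v::zfa \<Rightarrow> 'v" where
  "osucc \<alpha> = (THE s. is_set s \<and> elts s = insert \<alpha> (elts \<alpha>))"

text \<open>The finite ordinals of the universe, which need not be finite in the sense of HOL\<close>

definition natural_number :: "'v::zfa \<Rightarrow> bool" where
  "natural_number n \<longleftrightarrow>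
     ordinal n \<and> (\<forall>m\<in>insert n (elts n). elts m = {} \<or> (\<exists>k\<in>elts n. m = osucc k))"

definition infinite_cardinal :: "'v::zfa \<Rightarrow> bool" where
  "infinite_cardinal \<kappa> \<longleftrightarrow>
     ordinal \<kappa> \<and> (\<forall>\<beta>\<in>elts \<kappa>. \<nexists>f. is_bijection UNIV f (elts \<beta>) (elts \<kappa>)) \<and> \<not> natural_number \<kappa>"


section \<open>Groups of permutations of the atoms\<close>

definition permutation :: "'v::zfa \<Rightarrow> bool" where
  "permutation \<pi> \<longleftrightarrow> is_bijection UNIV \<pi> (elts Atoms) (elts Atoms)"

text \<open>The group of all permutations of the set of atoms that belong to the universe\<close>

definition Sym :: "'v::zfa monoid" where
  "Sym = \<lparr>carrier = {\<pi>. permutation \<pi>},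
          mult = (\<lambda>\<pi> \<sigma>. THE \<rho>. permutation \<rho> \<and>
                    (\<forall>a\<in>elts Atoms. app UNIV \<rho> a = app UNIV \<pi> (app UNIV \<sigma> a))),
          one = (THE \<rho>. permutation \<rho> \<and> (\<forall>a\<in>elts Atoms. app UNIV \<rho> a = a))\<rparr>"

definition permutation_group :: "'v::zfa \<Rightarrow> bool" where
  "permutation_group \<G> \<longleftrightarrow> is_set \<G> \<and> subgroup (elts \<G>) Sym"

definition subgroup_of :: "'v::zfa \<Rightarrow> 'v \<Rightarrow> bool" where
  "subgroup_of H \<G> \<longleftrightarrow> permutation_group H \<and> elts H \<subseteq> elts \<G>"

definition conjugate :: "'v::zfa \<Rightarrow> 'v set \<Rightarrow> 'v set" where
  "conjugate \<pi> H = (\<lambda>h. \<pi> \<otimes>\<^bsub>Sym\<^esub> h \<otimes>\<^bsub>Sym\<^esub> inv\<^bsub>Sym\<^esub> \<pi>) ` H"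

definition normal_filter :: "'v::zfa \<Rightarrow> 'v \<Rightarrow> bool" where
  "normal_filter \<F> \<G> \<longleftrightarrow>
     is_set \<F> \<and> elts \<F> \<noteq> {} \<and>
     (\<forall>H\<in>elts \<F>. subgroup_of H \<G>) \<and>
     (\<forall>H\<in>elts \<F>. \<forall>K. subgroup_of K \<G> \<and> elts H \<subseteq> elts K \<longrightarrow> K \<epsilon> \<F>) \<and>
     (\<forall>H\<in>elts \<F>. \<forall>K\<in>elts \<F>. \<exists>L\<in>elts \<F>. elts L = elts H \<inter> elts K) \<and>
     (\<forall>H\<in>elts \<F>. \<forall>\<pi>\<in>elts \<G>. \<exists>L\<in>elts \<F>. elts L = conjugate \<pi> (elts H))"

text \<open>Sequences of length \<open>\<gamma>\<close> are functions of the universe with domain \<open>\<gamma>\<close>.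
  The intersection of the empty sequence of subgroups of \<open>\<G>\<close> is \<open>\<G>\<close>.\<close>

definition shift_complete :: "'v::zfa \<Rightarrow> 'v \<Rightarrow> 'v \<Rightarrow> bool" where
  "shift_complete \<G> \<F> \<delta> \<longleftrightarrow>
     (\<forall>\<gamma>\<in>elts \<delta>. \<forall>H. is_function UNIV H (elts \<gamma>) (elts \<F>) \<longrightarrow>
        (\<exists>\<sigma>. is_function UNIV \<sigma> (elts \<gamma>) (elts \<G>) \<and>
           (let K = (\<lambda>\<alpha>. conjugate (app UNIV \<sigma> \<alpha>) (elts (app UNIV H \<alpha>)))
            in (\<exists>L\<in>elts \<F>. elts L = {\<pi> \<in> elts \<G>. \<forall>\<alpha>\<in>elts \<gamma>. \<pi> \<in> K \<alpha>}) \<and>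
               (\<forall>\<alpha>\<in>elts \<gamma>. \<forall>\<beta>\<in>elts \<gamma>. \<alpha> \<epsilon> \<beta> \<longrightarrow>
                  app UNIV \<sigma> \<beta> \<otimes>\<^bsub>Sym\<^esub> inv\<^bsub>Sym\<^esub> (app UNIV \<sigma> \<alpha>) \<in> K \<alpha>))))"


section \<open>The permutation model\<close>

definition transitive_set :: "'v::zfa \<Rightarrow> bool" where
  "transitive_set t \<longleftrightarrow> is_set t \<and> (\<forall>y\<in>elts t. elts y \<subseteq> elts t)"

definition transitive_closure :: "'v::zfa \<Rightarrow> 'v set" where
  "transitive_closure x = {y. \<forall>t. transitive_set t \<and> elts x \<subseteq> elts t \<longrightarrow> y \<epsilon> t}"

text \<open>The extension of \<open>\<pi>\<close> to the universe: the value at \<open>x\<close> of any function of the universe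
  that satisfies the recursion on a transitive set containing \<open>x\<close>\<close>

definition act :: "'v::zfa \<Rightarrow> 'v \<Rightarrow> 'v" where
  "act \<pi> x = (THE y. \<exists>t f. transitive_set t \<and> x \<epsilon> t \<and> is_function UNIV f (elts t) UNIV \<and>
     (\<forall>z\<in>elts t. if is_set z
        then is_set (app UNIV f z) \<and> elts (app UNIV f z) = app UNIV f ` elts z
        else app UNIV f z = app UNIV \<pi> z) \<and>
     y = app UNIV f x)"

definition symmetric :: "'v::zfa \<Rightarrow> 'v \<Rightarrow> 'v \<Rightarrow> bool" where
  "symmetric \<G> \<F> x \<longleftrightarrow> (\<exists>H\<in>elts \<F>. elts H = {\<pi> \<in> elts \<G>. act \<pi> x = x})"

definition HS :: "'v::zfa \<Rightarrow> 'v \<Rightarrow> 'v set" where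
  "HS \<G> \<F> = {x. \<forall>y\<in>insert x (transitive_closure x). symmetric \<G> \<F> y}"


section \<open>Dependent choice for trees\<close>

text \<open>The tree order \<open>R\<close> is strict.\<close>

definition is_tree :: "'v::zfa set \<Rightarrow> 'v \<Rightarrow> 'v \<Rightarrow> bool" where
  "is_tree M T R \<longleftrightarrow>
     is_set T \<and> is_set R \<and>
     irreflp_on (elts_in M T) (rel M R) \<and> transp_on (elts_in M T) (rel M R) \<and>
     (\<forall>t\<in>elts_in M T. well_ordered M {s \<in> elts_in M T. rel M R s t} (rel M R))"

definition is_chain :: "'v::zfa set \<Rightarrow> 'v \<Rightarrow> 'v \<Rightarrow> 'v \<Rightarrow> bool" where
  "is_chain M T R C \<longleftrightarrow> is_set C \<and> elts_in M C \<subseteq> elts_in M T \<and> totalp_on (elts_in M C) (rel M R)"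

definition has_order_type :: "'v::zfa set \<Rightarrow> 'v \<Rightarrow> 'v \<Rightarrow> 'v \<Rightarrow> bool" where
  "has_order_type M R C \<alpha> \<longleftrightarrow>
     (\<exists>f\<in>M. is_bijection M f (elts_in M \<alpha>) (elts_in M C) \<and>
        (\<forall>\<beta>\<in>elts_in M \<alpha>. \<forall>\<gamma>\<in>elts_in M \<alpha>. \<beta> \<epsilon> \<gamma> \<longleftrightarrow> rel M R (app M f \<beta>) (app M f \<gamma>)))"

definition closed_tree :: "'v::zfa set \<Rightarrow> 'v \<Rightarrow> 'v \<Rightarrow> 'v \<Rightarrow> bool" where
  "closed_tree M \<kappa> T R \<longleftrightarrow>
     (\<forall>C\<in>M. is_chain M T R C \<and> (\<exists>\<alpha>\<in>elts_in M \<kappa>. has_order_type M R C \<alpha>) \<longrightarrow>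
        (\<exists>t\<in>elts_in M T. \<forall>c\<in>elts_in M C. c = t \<or> rel M R c t))"

definition DC :: "'v::zfa set \<Rightarrow> 'v \<Rightarrow> bool" where
  "DC M \<kappa> \<longleftrightarrow>
     (\<forall>T\<in>M. \<forall>R\<in>M. is_tree M T R \<and> closed_tree M \<kappa> T R \<longrightarrow>
        (\<exists>C\<in>M. is_chain M T R C \<and> has_order_type M R C \<kappa>) \<or>
        (\<exists>t\<in>elts_in M T. \<forall>s\<in>elts_in M T. \<not> rel M R t s))"

end

theory Submission
  imports Defs
begin

text \<open>Write \<open>K\<^sub>\<alpha> = \<sigma>\<^sub>\<alpha> H\<^sub>\<alpha> \<sigma>\<^sub>\<alpha>\<inverse>\<close>. The condition \<open>\<sigma>\<^sub>\<beta> \<sigma>\<^sub>\<alpha>\<inverse> \<in> K\<^sub>\<alpha>\<close> says that \<open>\<sigma>\<^sub>\<beta>\<close> and \<open>\<sigma>\<^sub>\<alpha>\<close> agree on all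
  objects fixed by \<open>H\<^sub>\<alpha>\<close>. For sequences of successor length this makes the filter closed under
  intersections of fewer than \<open>\<kappa>\<close> subgroups, so a chain of order type below \<open>\<kappa>\<close> in a tree \<open>T\<close> of
  the model belongs to the model. Hence \<open>T\<close> is \<open>\<kappa>\<close>-closed in the universe, and dependent choice
  there yields a maximal element or a chain \<open>\<langle>t\<^sub>\<alpha> : \<alpha> < \<kappa>\<rangle>\<close> that need not lie in the model. In the latter case take
  \<open>H\<^sub>\<alpha>\<close> to be the stabilizer of \<open>t\<^sub>\<alpha>\<close> and of the tree: the elements \<open>\<sigma>\<^sub>0\<inverse> \<sigma>\<^sub>\<alpha> t\<^sub>\<alpha>\<close> form a chain of \<open>T\<close>
  that is fixed pointwise by a subgroup in the filter.

  Since separation and replacement are schemas over formulas, every class used along the way has to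
  be definable. Instead of writing formulas, definability is treated as a semantic closure property
  of predicates on environments.\<close>

section \<open>Definability\<close>

text \<open>Bound indices are counted too, so an index at or above the bound occurs nowhere in the
  formula and can serve as a fresh quantifier index.\<close>

primrec var_bound :: "fm \<Rightarrow> nat" where
  "var_bound (Mem i j) = Suc (max i j)"
| "var_bound (Eq i j) = Suc (max i j)"
| "var_bound (Neg p) = var_bound p"
| "var_bound (Conj p q) = max (var_bound p) (var_bound q)"
| "var_bound (Ex i p) = max (Suc i) (var_bound p)"

lemma sat_cong:
  fixes e e' :: "nat \<Rightarrow> 'v::zfa"
  assumes "\<And>i. i < var_bound p \<Longrightarrow> e i = e' i"
  shows "sat e p \<longleftrightarrow> sat e' p"
  using assms
proof (induction p arbitrary: e e')
  case (Neg p)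
  have "sat e p = sat e' p"
    by (rule Neg.IH) (use Neg.prems in simp)
  then show ?case by simp
next
  case (Conj p q)
  have "sat e p = sat e' p" "sat e q = sat e' q"
    by (intro Conj.IH; use Conj.prems in simp)+
  then show ?case by simp
next
  case (Ex i p)
  have "sat (e(i := x)) p = sat (e'(i := x)) p" for x
    by (rule Ex.IH) (use Ex.prems in auto)
  then show ?case by simp
qed simp_all

text \<open>Quantifiers bind named variables and \<open>r\<close> may be any map, injective or not,
  so capture has to be avoided; the induction does so by giving the bound variable a fresh
  name.\<close>

lemma sat_rename: "\<exists>q. \<forall>e::nat \<Rightarrow> 'v::zfa. sat e q \<longleftrightarrow> sat (\<lambda>n. e (r n)) p"
proof (induction p arbitrary: r)
  case (Mem i j)
  show ?case by (rule exI[of _ "Mem (r i) (r j)"]) simp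
next
  case (Eq i j)
  show ?case by (rule exI[of _ "Eq (r i) (r j)"]) simp
next
  case (Neg p)
  from Neg[of r] show ?case by (metis sat.simps(3))
next
  case (Conj p q)
  from Conj(1)[of r] Conj(2)[of r] show ?case by (metis sat.simps(4))
next
  case (Ex i p)
  \<comment> \<open>The sum bounds each \<open>r j\<close> with \<open>j < var_bound p\<close>, so
    no index occurring in \<open>p\<close> is renamed to \<open>k\<close>.\<close>
  define k where "k = Suc (\<Sum>j<var_bound p. r j)"
  have fresh: "r j \<noteq> k" if "j < var_bound p" for j
    using member_le_sum[of j "{..<var_bound p}" r] that by (auto simp: k_def)
  obtain q where q: "\<And>e::nat \<Rightarrow> 'v. sat e q \<longleftrightarrow> sat (\<lambda>n. e ((r(i := k)) n)) p"
    using Ex.IH[of "r(i := k)"] by blast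
  have "sat (\<lambda>n. (e(k := x)) ((r(i := k)) n)) p \<longleftrightarrow> sat ((\<lambda>n. e (r n))(i := x)) p"
    for e :: "nat \<Rightarrow> 'v" and x
    by (rule sat_cong) (use fresh in auto)
  then have "sat e (Ex k q) \<longleftrightarrow> sat (\<lambda>n. e (r n)) (Ex i p)" for e :: "nat \<Rightarrow> 'v"
    by (simp add: q del: fun_upd_apply)
  then show ?case by blast
qed

text \<open>Bridge from named to de Bruijn quantification: index 0 is renamed to the fresh
  \<open>k\<close>, the other indices move down by one, and then \<open>k\<close> is
  quantified.\<close>

lemma sat_exists: "\<exists>q. \<forall>e::nat \<Rightarrow> 'v::zfa. sat e q \<longleftrightarrow> (\<exists>x. sat (case_nat x e) p)"
proof -
  define k where "k = var_bound p"
  obtain q where q: "\<And>e::nat \<Rightarrow> 'v. sat e q \<longleftrightarrow> sat (\<lambda>n. e (case_nat k (\<lambda>n. n) n)) p"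
    using sat_rename[of "case_nat k (\<lambda>n. n)" p] by blast
  have "sat (\<lambda>n. (e(k := x)) (case_nat k (\<lambda>n. n) n)) p \<longleftrightarrow> sat (case_nat x e) p"
    for e :: "nat \<Rightarrow> 'v" and x
    by (rule sat_cong) (auto simp: k_def split: nat.splits)
  then have "sat e (Ex k q) \<longleftrightarrow> (\<exists>x. sat (case_nat x e) p)" for e :: "nat \<Rightarrow> 'v"
    by (simp add: q del: fun_upd_apply)
  then show ?thesis by blast
qed

text \<open>Variables and parameters each get an infinite stream, so either kind can be extended
  without knowing how many of the other a formula uses.\<close>

definition interleave :: "(nat \<Rightarrow> 'a) \<Rightarrow> (nat \<Rightarrow> 'a) \<Rightarrow> nat \<Rightarrow> 'a" where
  "interleave e c n = (if even n then e (n div 2) else c (n div 2))"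

lemma interleave_simps [simp]:
  "interleave e c (2 * n) = e n" "interleave e c (Suc (2 * n)) = c n"
  by (simp_all add: interleave_def)

text \<open>An environment \<open>e\<close> holds the free variables in de Bruijn order, \<open>c\<close> the parameters. Any
  element of the universe may be a parameter, so the constants of a predicate need no bookkeeping.\<close>

definition definable :: "((nat \<Rightarrow> 'v::zfa) \<Rightarrow> bool) \<Rightarrow> bool" where
  "definable P \<longleftrightarrow> (\<exists>p c. \<forall>e. P e \<longleftrightarrow> sat (interleave e c) p)"

definition definable_term :: "((nat \<Rightarrow> 'v::zfa) \<Rightarrow> 'v) \<Rightarrow> bool" where
  "definable_term t \<longleftrightarrow> definable (\<lambda>e. e 0 = t (\<lambda>n. e (Suc n)))"

named_theorems definable_intros

lemma definable_not [definable_intros]: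
  assumes "definable P"
  shows "definable (\<lambda>e. \<not> P e)"
  using assms unfolding definable_def by (metis sat.simps(3))

lemma definable_conj [definable_intros]:
  fixes P Q :: "(nat \<Rightarrow> 'v::zfa) \<Rightarrow> bool"
  assumes "definable P" "definable Q"
  shows "definable (\<lambda>e. P e \<and> Q e)"
proof -
  obtain p c where p: "\<And>e. P e \<longleftrightarrow> sat (interleave e c) p"
    using assms(1) unfolding definable_def by blast
  obtain q d where q: "\<And>e. Q e \<longleftrightarrow> sat (interleave e d) q"
    using assms(2) unfolding definable_def by blast
  \<comment> \<open>The two parameter streams are merged by a second interleaving: \<open>?r\<close>
    sends the parameters of \<open>p\<close> to its even places, \<open>?s\<close> those of
    \<open>q\<close> to its odd places.\<close>
  let ?r = "\<lambda>n. if even n then n else Suc (2 * (2 * (n div 2)))"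
  let ?s = "\<lambda>n. if even n then n else Suc (2 * (Suc (2 * (n div 2))))"
  obtain p' where p': "\<And>e::nat \<Rightarrow> 'v. sat e p' \<longleftrightarrow> sat (\<lambda>n. e (?r n)) p"
    using sat_rename[of ?r] by blast
  obtain q' where q': "\<And>e::nat \<Rightarrow> 'v. sat e q' \<longleftrightarrow> sat (\<lambda>n. e (?s n)) q"
    using sat_rename[of ?s] by blast
  have r: "(\<lambda>n. interleave e (interleave c d) (?r n)) = interleave e c" for e :: "nat \<Rightarrow> 'v"
  proof
    fix n show "interleave e (interleave c d) (?r n) = interleave e c n"
      by (cases "even n") (auto simp: interleave_def elim: oddE)
  qed
  have s: "(\<lambda>n. interleave e (interleave c d) (?s n)) = interleave e d" for e :: "nat \<Rightarrow> 'v"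
  proof
    fix n show "interleave e (interleave c d) (?s n) = interleave e d n"
      by (cases "even n") (auto simp: interleave_def elim: oddE)
  qed
  have "P e \<and> Q e \<longleftrightarrow> sat (interleave e (interleave c d)) (Conj p' q')" for e
    by (simp only: p q p' q' r s sat.simps)
  then show ?thesis unfolding definable_def by blast
qed

lemma definable_ex [definable_intros]:
  fixes Q :: "(nat \<Rightarrow> 'v::zfa) \<Rightarrow> 'v \<Rightarrow> bool"
  assumes "definable (\<lambda>e. Q (\<lambda>n. e (Suc n)) (e 0))"
  shows "definable (\<lambda>e. \<exists>x. Q e x)"
proof -
  obtain p c where p: "\<And>e. Q (\<lambda>n. e (Suc n)) (e 0) \<longleftrightarrow> sat (interleave e c) p"
    using assms unfolding definable_def by blast
  \<comment> \<open>\<open>sat_exists\<close> puts the new element in front of the whole interleaved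
    environment. Compared with \<open>interleave (case_nat x e) c\<close>, the old variables sit one
    place lower and the parameters one place higher.\<close>
  let ?r = "\<lambda>n. if n = 0 then 0 else if even n then n - 1 else Suc n"
  obtain p' where p': "\<And>e::nat \<Rightarrow> 'v. sat e p' \<longleftrightarrow> sat (\<lambda>n. e (?r n)) p"
    using sat_rename[of ?r] by blast
  obtain q where q: "\<And>e::nat \<Rightarrow> 'v. sat e q \<longleftrightarrow> (\<exists>x. sat (case_nat x e) p')"
    using sat_exists[of p'] by blast
  have r: "(\<lambda>n. case_nat x (interleave e c) (?r n)) = interleave (case_nat x e) c"
    for e :: "nat \<Rightarrow> 'v" and x
  proof
    fix n
    consider "n = 0" | m where "n = 2 * Suc m" | m where "n = Suc (2 * m)"
      by (metis Suc_eq_plus1 not0_implies_Suc oddE evenE mult_0_right)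
    then show "case_nat x (interleave e c) (?r n) = interleave (case_nat x e) c n"
      by cases (simp_all add: interleave_def)
  qed
  have "(\<exists>x. Q e x) \<longleftrightarrow> sat (interleave e c) q" for e
    using p[of "case_nat _ e"] by (simp add: q p' r)
  then show ?thesis unfolding definable_def by blast
qed

lemma definable_rename:
  fixes P :: "(nat \<Rightarrow> 'v::zfa) \<Rightarrow> bool"
  assumes "definable P"
  shows "definable (\<lambda>e. P (\<lambda>n. e (r n)))"
proof -
  obtain p c where p: "\<And>e. P e \<longleftrightarrow> sat (interleave e c) p"
    using assms unfolding definable_def by blast
  let ?r = "\<lambda>n. if even n then 2 * r (n div 2) else n"
  obtain q where q: "\<And>e::nat \<Rightarrow> 'v. sat e q \<longleftrightarrow> sat (\<lambda>n. e (?r n)) p"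
    using sat_rename[of ?r] by blast
  have r: "(\<lambda>n. interleave e c (?r n)) = interleave (\<lambda>n. e (r n)) c" for e :: "nat \<Rightarrow> 'v"
    by (auto simp: interleave_def)
  have "P (\<lambda>n. e (r n)) \<longleftrightarrow> sat (interleave e c) q" for e
    by (simp only: p q r)
  then show ?thesis unfolding definable_def by blast
qed

lemma definable_mem_var: "definable (\<lambda>e. e i \<epsilon> e j)"
  unfolding definable_def
  by (rule exI[of _ "Mem (2 * i) (2 * j)"]) simp

lemma definable_term_var [definable_intros]: "definable_term (\<lambda>e. e i)"
  unfolding definable_term_def definable_def
  by (rule exI[of _ "Eq (2 * 0) (2 * Suc i)"]) (simp only: sat.simps interleave_simps, simp)

lemma definable_term_const [definable_intros]: "definable_term (\<lambda>e. c)"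
  unfolding definable_term_def definable_def
  by (rule exI[of _ "Eq (2 * 0) (Suc (2 * 0))"], rule exI[of _ "\<lambda>_. c"])
     (simp only: sat.simps interleave_simps, simp)

text \<open>\<open>Q e (t e)\<close> says that some \<open>x\<close> on the graph of
  \<open>t\<close> satisfies \<open>Q e x\<close>, so a definable graph is all that is asked of a
  term.\<close>

lemma definable_subst:
  fixes P :: "(nat \<Rightarrow> 'v::zfa) \<Rightarrow> bool"
  assumes P: "definable (\<lambda>e. Q (\<lambda>n. e (Suc n)) (e 0))" and t: "definable_term t"
  shows "definable (\<lambda>e. Q e (t e))"
proof -
  have "definable (\<lambda>e. \<exists>x. x = t e \<and> Q e x)"
    by (rule definable_ex, rule definable_conj) (use t P in \<open>simp_all add: definable_term_def\<close>)
  then show ?thesis by simp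
qed

lemma definable_term_subst:
  assumes f: "definable_term (\<lambda>e. f (\<lambda>n. e (Suc n)) (e 0))" and t: "definable_term t"
  shows "definable_term (\<lambda>e. f e (t e))"
proof -
  have "definable_term (\<lambda>e. t (\<lambda>n. e (Suc n)))"
    using definable_rename[OF t[unfolded definable_term_def], of "case_nat 0 (\<lambda>n. Suc (Suc n))"]
    by (simp add: definable_term_def)
  \<comment> \<open>Indices 0 and 1 are exchanged: in the graph of \<open>f\<close> the value comes
    first, while the argument to be substituted must come first here.\<close>
  moreover have "definable (\<lambda>e. e (Suc 0) = f (\<lambda>n. e (Suc (Suc n))) (e 0))"
    using definable_rename[OF f[unfolded definable_term_def],
        of "\<lambda>n. case n of 0 \<Rightarrow> 1 | Suc 0 \<Rightarrow> 0 | Suc (Suc n) \<Rightarrow> Suc (Suc n)"]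
    by simp
  ultimately show ?thesis
    unfolding definable_term_def
    by (intro definable_subst[where Q = "\<lambda>e x. e 0 = f (\<lambda>n. e (Suc n)) x"])
       (simp_all add: definable_term_def)
qed

lemma definable_term_weaken:
  assumes "definable_term t"
  shows "definable_term (\<lambda>e. t (\<lambda>n. e (r n)))"
  using definable_rename[OF assms[unfolded definable_term_def], of "case_nat 0 (\<lambda>n. Suc (r n))"]
  by (simp add: definable_term_def)

text \<open>This rule and its variants for two arguments and for terms lift a definability proof
  from plain variables to arbitrary argument terms, so one proof per definition suffices.\<close>

lemma definable_subst1:
  assumes "definable (\<lambda>e. P (e 0))" "definable_term s"
  shows "definable (\<lambda>e. P (s e))"
  by (rule definable_subst[OF _ assms(2)]) (use assms(1) in simp)

lemma definable_subst2:
  assumes P: "definable (\<lambda>e. P (e 0) (e 1))" and s: "definable_term s" and t: "definable_term t"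
  shows "definable (\<lambda>e. P (s e) (t e))"
  \<comment> \<open>The map \<open>1 - n\<close> exchanges the indices 0 and 1, the only ones that
    \<open>P\<close> reads.\<close>
  by (rule definable_subst[OF _ s], rule definable_subst[OF _ definable_term_weaken[OF t]])
     (use definable_rename[OF P, of "\<lambda>n. 1 - n"] in simp)

lemma definable_term_subst1:
  assumes "definable_term (\<lambda>e. f (e 0))" "definable_term s"
  shows "definable_term (\<lambda>e. f (s e))"
  by (rule definable_term_subst[OF _ assms(2)]) (use assms(1) in simp)

lemma definable_term_subst2:
  assumes f: "definable_term (\<lambda>e. f (e 0) (e 1))" and s: "definable_term s" and t: "definable_term t"
  shows "definable_term (\<lambda>e. f (s e) (t e))"
  by (rule definable_term_subst[OF _ s], rule definable_term_subst[OF _ definable_term_weaken[OF t]])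
     (use definable_term_weaken[OF f, of "\<lambda>n. 1 - n"] in simp)

lemma definable_mem [definable_intros]:
  assumes "definable_term s" "definable_term t"
  shows "definable (\<lambda>e. s e \<epsilon> t e)"
  using definable_subst2[of "\<lambda>x y. x \<epsilon> y" s t] definable_mem_var[of 0 1] assms by blast

lemma definable_eq [definable_intros]:
  assumes s: "definable_term s" and t: "definable_term t"
  shows "definable (\<lambda>e. s e = t e)"
  by (rule definable_subst[where Q = "\<lambda>e x. x = t e", OF _ s])
     (use t in \<open>simp add: definable_term_def\<close>)

lemma definable_const [definable_intros]: "definable (\<lambda>e::nat \<Rightarrow> 'v::zfa. P)"
proof -
  have "definable (\<lambda>e::nat \<Rightarrow> 'v. e 0 = e 0)" "definable (\<lambda>e::nat \<Rightarrow> 'v. \<not> e 0 = e 0)"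
    by (intro definable_intros)+
  then show ?thesis by (cases P) simp_all
qed

lemma definable_disj [definable_intros]:
  assumes "definable P" "definable Q" shows "definable (\<lambda>e. P e \<or> Q e)"
proof -
  have "definable (\<lambda>e. \<not> (\<not> P e \<and> \<not> Q e))" by (intro definable_intros assms)
  then show ?thesis by simp
qed

lemma definable_imp [definable_intros]:
  assumes "definable P" "definable Q" shows "definable (\<lambda>e. P e \<longrightarrow> Q e)"
  using definable_disj[OF definable_not[OF assms(1)] assms(2)] by simp

lemma definable_iff [definable_intros]:
  assumes "definable P" "definable Q" shows "definable (\<lambda>e. P e \<longleftrightarrow> Q e)"
  using definable_conj[OF definable_imp[OF assms] definable_imp[OF assms(2,1)]]
  by (simp add: iff_conv_conj_imp)

lemma definable_all [definable_intros]:
  assumes "definable (\<lambda>e. Q (\<lambda>n. e (Suc n)) (e 0))"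
  shows "definable (\<lambda>e. \<forall>x. Q e x)"
proof -
  have "definable (\<lambda>e. \<not> (\<exists>x. \<not> Q e x))"
    by (rule definable_not, rule definable_ex, rule definable_not, rule assms)
  then show ?thesis by simp
qed

lemma definable_ex1 [definable_intros]:
  assumes "definable (\<lambda>e. Q (\<lambda>n. e (Suc n)) (e 0))"
  shows "definable (\<lambda>e. \<exists>!x. Q e x)"
  unfolding Ex1_def
  using assms definable_rename[OF assms, of "case_nat 0 (\<lambda>n. Suc (Suc n))"]
  by (intro definable_intros) simp_all

lemma definable_ball_elts [definable_intros]:
  assumes "definable_term t" "definable (\<lambda>e. Q (\<lambda>n. e (Suc n)) (e 0))"
  shows "definable (\<lambda>e. \<forall>x\<in>elts (t e). Q e x)"
proof -
  have "definable (\<lambda>e. \<forall>x. x \<epsilon> t e \<longrightarrow> Q e x)"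
    by (intro definable_intros definable_term_weaken[OF assms(1), of Suc] assms(2))
  then show ?thesis by (simp add: Ball_def elts_in_def)
qed

lemma definable_bex_elts [definable_intros]:
  assumes "definable_term t" "definable (\<lambda>e. Q (\<lambda>n. e (Suc n)) (e 0))"
  shows "definable (\<lambda>e. \<exists>x\<in>elts (t e). Q e x)"
proof -
  have "definable (\<lambda>e. \<exists>x. x \<epsilon> t e \<and> Q e x)"
    by (intro definable_intros definable_term_weaken[OF assms(1), of Suc] assms(2))
  then show ?thesis by (simp add: Bex_def elts_in_def)
qed

lemma definable_if [definable_intros]:
  assumes "definable P" "definable Q" "definable R"
  shows "definable (\<lambda>e. if P e then Q e else R e)"
  using definable_conj[OF definable_imp[OF assms(1,2)]
      definable_imp[OF definable_not[OF assms(1)] assms(3)]]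
  by (simp add: if_bool_eq_conj)

lemma definable_term_if [definable_intros]:
  assumes "definable P" "definable_term s" "definable_term t"
  shows "definable_term (\<lambda>e. if P e then s e else t e)"
  using definable_if[OF definable_rename[OF assms(1), of Suc] assms(2,3)[unfolded definable_term_def]]
  unfolding definable_term_def by (simp add: if_distrib)

lemma definable_is_set [definable_intros]:
  "definable_term t \<Longrightarrow> definable (\<lambda>e. is_set (t e))"
  unfolding is_set_def by (intro definable_intros)

text \<open>A fixed value for the failure of unique existence makes the description definable in all cases.\<close>

definition descr :: "('v::zfa \<Rightarrow> bool) \<Rightarrow> 'v" where
  "descr P = (if \<exists>!x. P x then THE x. P x else Atoms)"

lemma descr_eq: "P x \<Longrightarrow> (\<And>y. P y \<Longrightarrow> y = x) \<Longrightarrow> descr P = x"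
  unfolding descr_def by (metis the1_equality)

lemma definable_term_descr [definable_intros]:
  fixes P :: "(nat \<Rightarrow> 'v::zfa) \<Rightarrow> 'v \<Rightarrow> bool"
  assumes "definable (\<lambda>e. P (\<lambda>n. e (Suc n)) (e 0))"
  shows "definable_term (\<lambda>e. descr (P e))"
proof -
  have eq: "y = descr (P e) \<longleftrightarrow>
    (if \<exists>!x. P e x then P e y else y = Atoms)" for y e
    using theI'[of "P e"] the1_equality[of "P e"] unfolding descr_def by auto
  show ?thesis
    unfolding definable_term_def eq
    using assms definable_rename[OF assms, of "case_nat 0 (\<lambda>n. Suc (Suc n))"]
    by (intro definable_intros) simp_all
qed

text \<open>A total set builder: a class that is not a set yields the default of
  \<open>descr\<close>. Definability of the term therefore has no smallness condition; smallness
  enters only when its elements are computed.\<close>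

definition Coll :: "('v::zfa \<Rightarrow> bool) \<Rightarrow> 'v" where
  "Coll P = descr (\<lambda>s. is_set s \<and> (\<forall>u. u \<epsilon> s \<longleftrightarrow> P u))"

lemma definable_term_Coll [definable_intros]:
  assumes "definable (\<lambda>e. P (\<lambda>n. e (Suc n)) (e 0))"
  shows "definable_term (\<lambda>e. Coll (P e))"
  unfolding Coll_def
  using assms definable_rename[OF assms, of "case_nat 0 (\<lambda>n. Suc (Suc n))"]
  by (intro definable_intros) simp_all


section \<open>Sets, pairs and functions\<close>

lemma mem_elts_iff [iff]: "x \<in> elts y \<longleftrightarrow> x \<epsilon> y"
  by (simp add: elts_in_def)

lemma is_set_eqI:
  assumes "is_set x" "is_set y" "\<And>u. u \<epsilon> x \<longleftrightarrow> u \<epsilon> y"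
  shows "x = (y::'v::zfa)"
  using assms extensionality[of x y] by (auto simp: elts_in_def)

section \<open>Collections that are sets of the universe\<close>

definition small :: "'v::zfa set \<Rightarrow> bool" where
  "small X \<longleftrightarrow> (\<exists>s. is_set s \<and> elts s = X)"

lemma smallE:
  assumes "small X" obtains s where "is_set s" "\<And>u. u \<epsilon> s \<longleftrightarrow> u \<in> X"
  using assms unfolding small_def by auto

lemma Coll:
  assumes "small {u. P u}"
  shows is_set_Coll: "is_set (Coll P)" and mem_Coll: "u \<epsilon> Coll P \<longleftrightarrow> P u"
proof -
  obtain s where s: "is_set s" "\<And>u. u \<epsilon> s \<longleftrightarrow> P u"
    using smallE[OF assms] by auto
  have "Coll P = s"
    unfolding Coll_def by (rule descr_eq) (use s in \<open>auto intro: is_set_eqI\<close>)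
  then show "is_set (Coll P)" "u \<epsilon> Coll P \<longleftrightarrow> P u" using s by auto
qed

lemma small_separation:
  assumes "definable (\<lambda>e. P (e 0))"
  shows "small {u. u \<epsilon> (x::'v::zfa) \<and> P u}"
proof -
  obtain p c where p: "\<And>e. P (e 0) \<longleftrightarrow> sat (interleave e c) p"
    using assms unfolding definable_def by blast
  \<comment> \<open>The separation axiom varies index 0 only. Since \<open>P\<close> looks at
    \<open>e 0\<close> alone, all variables may read the candidate there, and the parameters move to
    the indices from 1 on.\<close>
  obtain q where q: "\<And>e::nat \<Rightarrow> 'v. sat e q \<longleftrightarrow>
      sat (\<lambda>n. e ((\<lambda>n. if even n then 0 else Suc (n div 2)) n)) p"
    using sat_rename[of "\<lambda>n. if even n then 0 else Suc (n div 2)" p] by blast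
  have "(\<lambda>n. (((case_nat x c)(0 := u)) ((\<lambda>n. if even n then 0 else Suc (n div 2)) n)))
      = interleave (\<lambda>_. u) c" for u
    by (auto simp: interleave_def)
  then have "P u \<longleftrightarrow> sat ((case_nat x c)(0 := u)) q" for u
    using p[of "\<lambda>_. u"] by (simp only: q)
  then show ?thesis
    using separation[of x "case_nat x c" q] by (simp add: small_def)
qed

lemma small_elts [simp]: "small (elts (x::'v::zfa))"
  using small_separation[of "\<lambda>_. True" x] by (simp add: definable_const elts_in_def)

lemma small_Collect_conj:
  assumes "small X" "definable (\<lambda>e. P (e 0))"
  shows "small {u. u \<in> X \<and> P u}"
proof -
  obtain x where "\<And>u. u \<epsilon> x \<longleftrightarrow> u \<in> X" using smallE[OF assms(1)] by blast
  then show ?thesis using small_separation[OF assms(2), of x] by simp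
qed

lemma small_image:
  fixes X :: "'v::zfa set"
  assumes "small X" "definable_term (\<lambda>e. F (e 0))"
  shows "small (F ` X)"
proof -
  obtain x where x: "\<And>u. u \<epsilon> x \<longleftrightarrow> u \<in> X"
    using smallE[OF assms(1)] by blast
  obtain p c where p: "\<And>e. e 0 = F (e 1) \<longleftrightarrow> sat (interleave e c) p"
    using assms(2) unfolding definable_term_def definable_def by auto
  \<comment> \<open>In the graph of \<open>F\<close> index 0 is the value and index 1 the argument.
    The replacement axiom has the argument at 0 and the value at 1, with the parameters following
    from 2 on.\<close>
  define r :: "nat \<Rightarrow> nat" where "r n =
    (if n = 0 then 1 else if even n then 0 else Suc (Suc (n div 2)))" for n
  obtain q where q: "\<And>e::nat \<Rightarrow> 'v. sat e q \<longleftrightarrow> sat (\<lambda>n. e (r n)) p"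
    using sat_rename[of r p] by blast
  have "(\<lambda>n. ((case_nat x (case_nat x c))(0 := u, 1 := v)) (r n))
      = interleave (case_nat v (\<lambda>_. u)) c" for u v
  proof
    fix n
    consider "n = 0" | m where "n = 2 * Suc m" | m where "n = Suc (2 * m)"
      by (metis Suc_eq_plus1 not0_implies_Suc oddE evenE mult_0_right)
    then show "((case_nat x (case_nat x c))(0 := u, 1 := v)) (r n)
        = interleave (case_nat v (\<lambda>_. u)) c n"
      by cases (simp_all add: interleave_def r_def)
  qed
  then have F: "v = F u \<longleftrightarrow> sat ((case_nat x (case_nat x c))(0 := u, 1 := v)) q" for u v
    using p[of "case_nat v (\<lambda>_. u)"] by (simp only: q) simp
  have "{v. \<exists>u\<in>elts x. v = F u} = F ` X"
    using x by auto
  then show ?thesis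
    using replacement[of x "case_nat x (case_nat x c)" q] unfolding F[symmetric] small_def by auto
qed

lemma small_UN:
  assumes "small X" "definable_term (\<lambda>e. F (e 0))"
  shows "small (\<Union>x\<in>X. elts (F x))"
proof -
  obtain s where "is_set s" "elts s = F ` X"
    using small_image[OF assms] by (auto simp: small_def)
  then show ?thesis using union[of s] by (auto simp: small_def)
qed

lemma small_Un:
  assumes "small X" "small Y" shows "small (X \<union> Y)"
proof -
  obtain x y z where "X = elts x" "Y = elts y" "elts z = {x, y}"
    using assms pairing unfolding small_def by metis
  then show ?thesis using union[of z] by (auto simp: small_def)
qed

lemma small_pair: "small {x, y}"
  using pairing[of x y] by (simp add: small_def)

lemma small_insert: "small X \<Longrightarrow> small (insert x X)"
  using small_Un[OF small_pair[of x x]] by simp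

lemma definable_transitive_set [definable_intros]:
  "definable_term t \<Longrightarrow> definable (\<lambda>e. transitive_set (t e))"
  by (rule definable_subst1) (simp_all add: transitive_set_def subset_eq, intro definable_intros)

lemma transitive_set_iff: "transitive_set t \<longleftrightarrow> is_set t \<and> (\<forall>y x. y \<epsilon> t \<longrightarrow> x \<epsilon> y \<longrightarrow> x \<epsilon> t)"
  by (auto simp: transitive_set_def)

lemma transitive_setD: "transitive_set t \<Longrightarrow> x \<epsilon> y \<Longrightarrow> y \<epsilon> t \<Longrightarrow> x \<epsilon> t"
  by (auto simp: transitive_set_def)

section \<open>Pairs and functions\<close>

definition upair :: "'v::zfa \<Rightarrow> 'v \<Rightarrow> 'v" where
  "upair x y = Coll (\<lambda>u. u = x \<or> u = y)"

definition opair :: "'v::zfa \<Rightarrow> 'v \<Rightarrow> 'v" where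
  "opair x y = upair (upair x x) (upair x y)"

lemma upair [simp]: "is_set (upair x y)" "u \<epsilon> upair x y \<longleftrightarrow> u = x \<or> u = y"
proof -
  have "{x, y} = {u. u = x \<or> u = y}" by auto
  then have "small {u. u = x \<or> u = y}" by (metis small_pair)
  then show "is_set (upair x y)" "u \<epsilon> upair x y \<longleftrightarrow> u = x \<or> u = y"
    unfolding upair_def by (simp_all add: Coll)
qed

lemma is_set_opair [simp]: "is_set (opair x y)"
  by (simp add: opair_def)

lemma upair_inject: "upair x y = upair u v \<longleftrightarrow> x = u \<and> y = v \<or> x = v \<and> y = u"
proof
  assume "upair x y = upair u v"
  then have "w = x \<or> w = y \<longleftrightarrow> w = u \<or> w = v" for w by (metis upair(2))
  then show "x = u \<and> y = v \<or> x = v \<and> y = u" by metis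
next
  show "x = u \<and> y = v \<or> x = v \<and> y = u \<Longrightarrow> upair x y = upair u v"
    by (auto intro: is_set_eqI)
qed

lemma opair_inject [simp]: "opair x y = opair u v \<longleftrightarrow> x = u \<and> y = v"
  unfolding opair_def upair_inject by blast

lemma definable_term_upair [definable_intros]:
  "definable_term s \<Longrightarrow> definable_term t \<Longrightarrow> definable_term (\<lambda>e. upair (s e) (t e))"
  by (rule definable_term_subst2) (simp_all add: upair_def, intro definable_intros)

lemma definable_term_opair [definable_intros]:
  "definable_term s \<Longrightarrow> definable_term t \<Longrightarrow> definable_term (\<lambda>e. opair (s e) (t e))"
  unfolding opair_def by (intro definable_intros)

lemma is_upair_UNIV [simp]: "is_upair UNIV z x y \<longleftrightarrow> z = upair x y"
  by (auto simp: is_upair_def intro: is_set_eqI)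

lemma is_pair_UNIV [simp]: "is_pair UNIV p x y \<longleftrightarrow> p = opair x y"
  by (simp add: is_pair_def opair_def)

lemma rel_UNIV [simp]: "rel UNIV r x y \<longleftrightarrow> opair x y \<epsilon> r"
  by (simp add: rel_def)

text \<open>A definable substitute for \<open>app\<close>, whose \<open>THE\<close> is unspecified
  outside the domain; the two agree on the domain of a function.\<close>

definition appl :: "'v::zfa \<Rightarrow> 'v \<Rightarrow> 'v" where
  "appl f x = descr (\<lambda>y. opair x y \<epsilon> f)"

lemma definable_term_appl [definable_intros]:
  "definable_term s \<Longrightarrow> definable_term t \<Longrightarrow> definable_term (\<lambda>e. appl (s e) (t e))"
  by (rule definable_term_subst2) (simp_all add: appl_def, intro definable_intros)

lemma function_appl:
  assumes "is_function UNIV f X Y" "x \<in> X"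
  shows app_eq_appl: "app UNIV f x = appl f x"
    and opair_mem_function: "opair x y \<epsilon> f \<longleftrightarrow> y = appl f x"
    and appl_mem: "appl f x \<in> Y"
proof -
  have "\<exists>!y. opair x y \<epsilon> f"
    using assms by (simp add: is_function_def)
  then obtain z where z: "opair x z \<epsilon> f" "\<And>y. opair x y \<epsilon> f \<Longrightarrow> y = z"
    by metis
  have "appl f x = z" unfolding appl_def by (rule descr_eq) (use z in blast)+
  moreover have "app UNIV f x = z"
    unfolding app_def rel_UNIV by (rule the_equality) (use z in blast)+
  ultimately show "app UNIV f x = appl f x" "opair x y \<epsilon> f \<longleftrightarrow> y = appl f x"
    using z by blast+
  have "opair x z \<in> elts f" using z(1) by simp
  then obtain x' y' where "y' \<in> Y" "opair x z = opair x' y'"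
    using assms(1) unfolding is_function_def is_pair_UNIV by meson
  then show "appl f x \<in> Y"
    using \<open>appl f x = z\<close> by simp
qed

lemma mem_function:
  assumes "is_function UNIV f X Y"
  shows "p \<epsilon> f \<longleftrightarrow> (\<exists>x\<in>X. p = opair x (appl f x))"
proof
  assume "p \<epsilon> f"
  then have "p \<in> elts f" by simp
  then obtain x y where "x \<in> X" "p = opair x y"
    using assms unfolding is_function_def is_pair_UNIV by meson
  then show "\<exists>x\<in>X. p = opair x (appl f x)"
    using opair_mem_function[OF assms, of x y] \<open>p \<epsilon> f\<close> by auto
qed (use opair_mem_function[OF assms] in auto)

lemma function_eqI:
  assumes f: "is_function UNIV f X Y" and g: "is_function UNIV g X Z"
    and eq: "\<And>x. x \<in> X \<Longrightarrow> appl f x = appl g x"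
  shows "f = g"
proof (rule is_set_eqI)
  show "is_set f" "is_set g" using f g by (simp_all add: is_function_def)
  show "p \<epsilon> f \<longleftrightarrow> p \<epsilon> g" for p
    using eq by (auto simp: mem_function[OF f] mem_function[OF g])
qed

definition lam :: "'v::zfa \<Rightarrow> ('v \<Rightarrow> 'v) \<Rightarrow> 'v" where
  "lam a F = Coll (\<lambda>p. \<exists>x. x \<epsilon> a \<and> p = opair x (F x))"

lemma lam:
  assumes F: "definable_term (\<lambda>e. F (e 0))"
  shows is_function_lam: "(\<And>x. x \<epsilon> a \<Longrightarrow> F x \<in> Y) \<Longrightarrow> is_function UNIV (lam a F) (elts a) Y"
    and appl_lam: "x \<epsilon> a \<Longrightarrow> appl (lam a F) x = F x"
proof -
  have "small ((\<lambda>x. opair x (F x)) ` elts a)"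
    by (rule small_image) (intro small_elts definable_intros F)+
  moreover have "(\<lambda>x. opair x (F x)) ` elts a = {p. \<exists>x. x \<epsilon> a \<and> p = opair x (F x)}"
    by auto
  ultimately have s: "small {p. \<exists>x. x \<epsilon> a \<and> p = opair x (F x)}" by simp
  have m: "p \<epsilon> lam a F \<longleftrightarrow> (\<exists>x. x \<epsilon> a \<and> p = opair x (F x))" for p
    unfolding lam_def by (rule mem_Coll[OF s])
  have f: "is_function UNIV (lam a F) (elts a) Y" if "\<And>x. x \<epsilon> a \<Longrightarrow> F x \<in> Y" for Y
    using that is_set_Coll[OF s] unfolding is_function_def lam_def[symmetric]
    by (auto simp: m)
  then show "(\<And>x. x \<epsilon> a \<Longrightarrow> F x \<in> Y) \<Longrightarrow> is_function UNIV (lam a F) (elts a) Y" .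
  show "appl (lam a F) x = F x" if "x \<epsilon> a"
    using opair_mem_function[OF f[of UNIV], of x "F x"] that by (auto simp: m)
qed


section \<open>Induction and recursion along membership\<close>

text \<open>Foundation concerns sets of the universe only. For a definable \<open>P\<close> the
  candidates inside \<open>t\<close> form such a set, which is why induction is restricted to
  definable predicates.\<close>

lemma mem_minimal:
  assumes "definable (\<lambda>e. P (e 0))" "x \<epsilon> t" "P x"
  obtains y where "y \<epsilon> t" "P y" "\<And>z. z \<epsilon> y \<Longrightarrow> z \<epsilon> t \<Longrightarrow> \<not> P z"
proof -
  obtain s where s: "\<And>u. u \<epsilon> s \<longleftrightarrow> u \<epsilon> t \<and> P u"
    using smallE[OF small_separation[OF assms(1), of t]] by auto
  then have "elts s \<noteq> {}" using assms by auto
  from foundation[OF this] show ?thesis using s that by (auto simp: disjoint_iff)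
qed

lemma transitive_set_induct:
  assumes "transitive_set t" "definable (\<lambda>e. P (e 0))" "x \<epsilon> t"
    and step: "\<And>x. x \<epsilon> t \<Longrightarrow> (\<And>y. y \<epsilon> x \<Longrightarrow> P y) \<Longrightarrow> P x"
  shows "P x"
proof (rule ccontr)
  assume "\<not> P x"
  have "definable (\<lambda>e. \<not> P (e 0))" by (intro definable_intros assms)
  then obtain y where "y \<epsilon> t" "\<not> P y" "\<And>z. z \<epsilon> y \<Longrightarrow> z \<epsilon> t \<Longrightarrow> \<not> \<not> P z"
    using mem_minimal[of "\<lambda>x. \<not> P x", OF _ assms(3) \<open>\<not> P x\<close>] by metis
  then show False using step assms(1) transitive_setD by blast
qed

definition img :: "'v::zfa \<Rightarrow> 'v \<Rightarrow> 'v" where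
  "img f z = Coll (\<lambda>v. \<exists>y. y \<epsilon> z \<and> v = appl f y)"

lemma definable_term_img [definable_intros]:
  "definable_term s \<Longrightarrow> definable_term t \<Longrightarrow> definable_term (\<lambda>e. img (s e) (t e))"
  by (rule definable_term_subst2) (simp_all add: img_def, intro definable_intros)

lemma img: "is_set (img f z)" "v \<epsilon> img f z \<longleftrightarrow> (\<exists>y. y \<epsilon> z \<and> v = appl f y)"
proof -
  have "small (appl f ` elts z)"
    by (rule small_image) (intro small_elts definable_intros)+
  moreover have "appl f ` elts z = {v. \<exists>y. y \<epsilon> z \<and> v = appl f y}" by auto
  ultimately have s: "small {v. \<exists>y. y \<epsilon> z \<and> v = appl f y}" by simp
  show "is_set (img f z)" "v \<epsilon> img f z \<longleftrightarrow> (\<exists>y. y \<epsilon> z \<and> v = appl f y)"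
    unfolding img_def by (rule is_set_Coll[OF s], rule mem_Coll[OF s])
qed

text \<open>\<open>G\<close> receives a point and the set of values at its elements. Approximations
  on transitive sets agree wherever both are defined, so their common value \<open>val\<close> is
  definable; induction along membership then shows that an approximation reaches every point of
  \<open>t\<close>.\<close>

lemma transitive_set_recursion:
  fixes G :: "'v::zfa \<Rightarrow> 'v \<Rightarrow> 'v"
  assumes G: "definable_term (\<lambda>e. G (e 0) (e 1))" and t: "transitive_set t"
  obtains f where "is_function UNIV f (elts t) UNIV"
    "\<And>z. z \<epsilon> t \<Longrightarrow> appl f z = G z (img f z)"
proof -
  note G' [definable_intros] = definable_term_subst2[OF G]
  define appr where "appr s f \<longleftrightarrow> transitive_set s \<and> (\<forall>z\<in>elts s. appl f z = G z (img f z))" for s f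
  have [definable_intros]: "definable (\<lambda>e. appr (s e) (f e))"
    if "definable_term s" "definable_term f" for s f
    by (rule definable_subst2[OF _ that]) (simp add: appr_def, intro definable_intros)
  have unique: "appl f z = appl f' z"
    if a: "appr s f" "appr s' f'" and z: "z \<epsilon> s" "z \<epsilon> s'" for s f s' f' z
  proof -
    have "definable (\<lambda>e. e 0 \<epsilon> s' \<longrightarrow> appl f (e 0) = appl f' (e 0))"
      by (intro definable_intros)
    then have "z \<epsilon> s' \<longrightarrow> appl f z = appl f' z"
    proof (rule transitive_set_induct[of s, rotated])
      show "transitive_set s" using a by (simp add: appr_def)
      fix x assume x: "x \<epsilon> s" "\<And>y. y \<epsilon> x \<Longrightarrow> y \<epsilon> s' \<longrightarrow> appl f y = appl f' y"
      show "x \<epsilon> s' \<longrightarrow> appl f x = appl f' x"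
      proof
        assume "x \<epsilon> s'"
        then have "appl f y = appl f' y" if "y \<epsilon> x" for y
          using x(2)[OF that] a(2) that by (auto simp: appr_def dest: transitive_setD)
        then have "img f x = img f' x"
          by (intro is_set_eqI) (auto simp: img)
        then show "appl f x = appl f' x"
          using a x(1) \<open>x \<epsilon> s'\<close> by (simp add: appr_def)
      qed
    qed (rule z(1))
    then show ?thesis using z by simp
  qed
  define val where "val z = descr (\<lambda>v. \<exists>s f. appr s f \<and> z \<epsilon> s \<and> v = appl f z)" for z
  have [definable_intros]: "definable_term (\<lambda>e. val (z e))" if "definable_term z" for z
    by (rule definable_term_subst1[OF _ that]) (simp add: val_def, intro definable_intros)
  have val: "val z = appl f z" if "appr s f" "z \<epsilon> s" for s f z
    unfolding val_def by (rule descr_eq) (use that unique in blast)+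
  define reach where "reach z \<longleftrightarrow> (\<exists>s f. appr s f \<and> z \<epsilon> s)" for z
  have reach_definable [definable_intros]: "definable (\<lambda>e. reach (z e))" if "definable_term z" for z
    by (rule definable_subst1[OF _ that]) (simp add: reach_def, intro definable_intros)
  have reach_mem: "reach y" if "y \<epsilon> z" "reach z" for y z
    using that unfolding reach_def appr_def by (meson transitive_setD)
  \<comment> \<open>One recursion step on top of \<open>val\<close>. It gives the right value also
    at a point whose elements are all reached but which is not yet known to be reached
    itself.\<close>
  define val' where "val' z = G z (Coll (\<lambda>v. \<exists>y. y \<epsilon> z \<and> v = val y))" for z
  have val'_definable: "definable_term (\<lambda>e. val' (e 0))"
    unfolding val'_def by (intro definable_intros)
  have val_val': "val z = val' z" if "reach z" for z
  proof -
    obtain s f where sf: "appr s f" "z \<epsilon> s" using \<open>reach z\<close> by (auto simp: reach_def)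
    have "\<And>y. y \<epsilon> z \<Longrightarrow> val y = appl f y"
      using sf val[OF sf(1)] unfolding appr_def by (meson transitive_setD)
    then have "(\<lambda>v. \<exists>y. y \<epsilon> z \<and> v = val y) = (\<lambda>v. \<exists>y. y \<epsilon> z \<and> v = appl f y)"
      by (auto intro!: ext)
    then show ?thesis
      using sf val[OF sf] by (simp add: val'_def img_def appr_def)
  qed
  have approximation: "appl (lam s val') z = G z (img (lam s val') z)"
    if s: "\<And>y z. y \<epsilon> z \<Longrightarrow> z \<epsilon> s \<Longrightarrow> y \<epsilon> s \<and> reach y" and z: "z \<epsilon> s" for s z
  proof -
    have "appl (lam s val') y = val y" if "y \<epsilon> z" for y
      using s[OF that z] by (simp add: appl_lam[OF val'_definable] val_val')
    then have "(\<lambda>v. \<exists>y. y \<epsilon> z \<and> v = val y) = (\<lambda>v. \<exists>y. y \<epsilon> z \<and> v = appl (lam s val') y)"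
      by (auto intro!: ext)
    then show ?thesis
      using z by (simp add: appl_lam[OF val'_definable] val'_def img_def)
  qed
  have reach: "reach z" if "z \<epsilon> t" for z
  proof (rule transitive_set_induct[OF t _ that])
    show "definable (\<lambda>e. reach (e 0))" by (intro definable_intros)
    fix x assume x: "x \<epsilon> t" "\<And>y. y \<epsilon> x \<Longrightarrow> reach y"
    \<comment> \<open>The reached points of \<open>t\<close> together with \<open>x\<close> form a
      transitive set, because all elements of \<open>x\<close> are reached. On it
      \<open>val'\<close> is an approximation defined at \<open>x\<close>.\<close>
    have "small (insert x {u. u \<epsilon> t \<and> reach u})"
      by (intro small_insert small_separation definable_intros)
    then obtain s where s: "is_set s" "\<And>u. u \<epsilon> s \<longleftrightarrow> u = x \<or> u \<epsilon> t \<and> reach u"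
      by (auto elim: smallE)
    have sub: "y \<epsilon> s \<and> reach y" if "y \<epsilon> z" "z \<epsilon> s" for y z
    proof -
      have "z \<epsilon> t" using \<open>z \<epsilon> s\<close> x(1) by (auto simp: s(2))
      then have "y \<epsilon> t" using transitive_setD[OF t \<open>y \<epsilon> z\<close>] by simp
      moreover have "reach y" using \<open>z \<epsilon> s\<close> x(2) reach_mem \<open>y \<epsilon> z\<close> by (auto simp: s(2))
      ultimately show ?thesis by (simp add: s(2))
    qed
    have "transitive_set s"
      using s(1) sub unfolding transitive_set_iff by blast
    then have "appr s (lam s val')"
      using approximation[of s] sub by (auto simp: appr_def)
    then show "reach x" using s(2) by (auto simp: reach_def)
  qed
  show ?thesis
  proof (rule that[of "lam t val'"])
    show "is_function UNIV (lam t val') (elts t) UNIV"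
      by (rule is_function_lam[OF val'_definable]) simp
    show "appl (lam t val') z = G z (img (lam t val') z)" if "z \<epsilon> t" for z
      by (rule approximation) (use that t reach in \<open>auto dest: transitive_setD\<close>)
  qed
qed

text \<open>The recursion below only needs a transitive set without a last element, so the set of
  natural numbers can be avoided.\<close>

lemma exists_unbounded_transitive_set:
  obtains w :: "'v::zfa" where "transitive_set w" "\<exists>z. z \<epsilon> w" "\<And>n. n \<epsilon> w \<Longrightarrow> \<exists>s. s \<epsilon> w \<and> n \<epsilon> s"
proof -
  obtain w :: 'v where zero: "\<exists>z. z \<epsilon> w \<and> is_set z \<and> elts z = {}"
    and succ: "\<And>n. n \<epsilon> w \<Longrightarrow> \<exists>s. s \<epsilon> w \<and> is_set s \<and> elts s = insert n (elts n)"
    using infinity by (metis mem_elts_iff)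
  \<comment> \<open>The set given by infinity may contain irrelevant members. Those kept are
    transitive sets of transitive sets from \<open>w\<close>, a condition inherited by their
    elements and by successors.\<close>
  let ?P = "\<lambda>n::'v. transitive_set n \<and> (\<forall>m\<in>elts n. transitive_set m \<and> m \<epsilon> w)"
  have "small {n. n \<epsilon> w \<and> ?P n}"
    by (rule small_separation) (intro definable_intros)
  then obtain v where v: "is_set v" "\<And>n. n \<epsilon> v \<longleftrightarrow> n \<epsilon> w \<and> ?P n"
    by (auto elim: smallE)
  show ?thesis
  proof (rule that[of v])
    have "x \<epsilon> v" if "y \<epsilon> v" "x \<epsilon> y" for x y
    proof -
      have y: "transitive_set y" "\<And>m. m \<epsilon> y \<Longrightarrow> transitive_set m \<and> m \<epsilon> w"
        using \<open>y \<epsilon> v\<close> v(2) by auto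
      then have "m \<epsilon> y" if "m \<epsilon> x" for m
        using transitive_setD that \<open>x \<epsilon> y\<close> by blast
      then show ?thesis using y \<open>x \<epsilon> y\<close> v(2) by simp
    qed
    then show "transitive_set v"
      using v(1) by (auto simp: transitive_set_iff)
    show "\<exists>z. z \<epsilon> v"
      using zero by (auto simp: v transitive_set_def)
    fix n assume n: "n \<epsilon> v"
    then obtain s where s: "s \<epsilon> w" "is_set s" "elts s = insert n (elts n)"
      using succ v by blast
    have mem_s: "u \<epsilon> s \<longleftrightarrow> u = n \<or> u \<epsilon> n" for u
      using s(3) by (metis insert_iff mem_elts_iff)
    have "transitive_set n" "\<And>m. m \<epsilon> n \<Longrightarrow> transitive_set m \<and> m \<epsilon> w" "n \<epsilon> w"
      using n by (simp_all add: v)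
    moreover from this(1) have "transitive_set s"
      using s(2) by (auto simp: transitive_set_iff mem_s)
    ultimately have "s \<epsilon> v"
      using s(1) by (auto simp: v(2) mem_s)
    then show "\<exists>s. s \<epsilon> v \<and> n \<epsilon> s"
      using mem_s by blast
  qed
qed

text \<open>The union operation is iterated along the unbounded set \<open>w\<close>, and the union
  of all stages is transitive.\<close>

lemma exists_transitive_set:
  fixes x :: "'v::zfa"
  obtains t where "transitive_set t" "x \<epsilon> t"
proof -
  obtain w :: 'v where w: "transitive_set w" "\<exists>z. z \<epsilon> w" "\<And>n. n \<epsilon> w \<Longrightarrow> \<exists>s. s \<epsilon> w \<and> n \<epsilon> s"
    using exists_unbounded_transitive_set by blast
  \<comment> \<open>With \<open>s\<close> the set of earlier stages, the new stage consists of
    \<open>x\<close> and of the elements of elements of earlier stages.\<close>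
  define P where "P s u \<longleftrightarrow> u = x \<or> (\<exists>v. v \<epsilon> s \<and> (\<exists>a. a \<epsilon> v \<and> u \<epsilon> a))" for s u
  define U :: "'v \<Rightarrow> 'v" where "U s = Coll (\<lambda>a. \<exists>v. v \<epsilon> s \<and> a \<epsilon> v)" for s
  have U: "a \<epsilon> U s \<longleftrightarrow> (\<exists>v. v \<epsilon> s \<and> a \<epsilon> v)" for a s
    unfolding U_def
  proof (rule mem_Coll)
    have "small (\<Union>v\<in>elts s. elts v)"
      using union[of s] by (simp only: small_def)
    moreover have "(\<Union>v\<in>elts s. elts v) = {a. \<exists>v. v \<epsilon> s \<and> a \<epsilon> v}" by auto
    ultimately show "small {a. \<exists>v. v \<epsilon> s \<and> a \<epsilon> v}" by simp
  qed
  have "small {u. P s u}" for s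
  proof -
    have "small (insert x (elts (U (U s))))"
      by (intro small_insert small_elts)
    moreover have "insert x (elts (U (U s))) = {u. P s u}"
      unfolding set_eq_iff by (simp add: U P_def) blast
    ultimately show ?thesis by simp
  qed
  note Coll_P = mem_Coll[OF this]
  have G: "definable_term (\<lambda>e. Coll (P (e 1)))"
    unfolding P_def by (intro definable_intros)
  obtain f where f: "\<And>z. z \<epsilon> w \<Longrightarrow> appl f z = Coll (P (img f z))"
    using transitive_set_recursion[of "\<lambda>_ s. Coll (P s)", OF G w(1)] by blast
  have mem_f: "u \<epsilon> appl f n \<longleftrightarrow> u = x \<or> (\<exists>m a. m \<epsilon> n \<and> a \<epsilon> appl f m \<and> u \<epsilon> a)"
    if "n \<epsilon> w" for u n
    using f[OF that] by (auto simp: Coll_P P_def img)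
  have "small (\<Union>n\<in>elts w. elts (appl f n))"
    by (rule small_UN) (intro small_elts definable_intros)+
  then obtain t where t: "is_set t" "\<And>u. u \<epsilon> t \<longleftrightarrow> (\<exists>n. n \<epsilon> w \<and> u \<epsilon> appl f n)"
    by (rule smallE) (simp add: Bex_def)
  show ?thesis
  proof (rule that[of t])
    show "x \<epsilon> t" using w(2) by (auto simp: t(2) mem_f)
    have "u \<epsilon> t" if "u \<epsilon> y" "y \<epsilon> t" for u y
    proof -
      obtain n where n: "n \<epsilon> w" "y \<epsilon> appl f n" using \<open>y \<epsilon> t\<close> t(2) by blast
      \<comment> \<open>Unboundedness of \<open>w\<close> provides a later stage, which contains all
        elements of members of stage \<open>n\<close>.\<close>
      obtain s where s: "s \<epsilon> w" "n \<epsilon> s" using w(3) n(1) by blast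
      then have "u \<epsilon> appl f s" using n \<open>u \<epsilon> y\<close> unfolding mem_f[OF s(1)] by blast
      then show ?thesis using s(1) t(2) by blast
    qed
    then show "transitive_set t" using t(1) by (auto simp: transitive_set_def)
  qed
qed

lemma mem_induct:
  assumes "definable (\<lambda>e. P (e 0))" "\<And>x. (\<And>y. y \<epsilon> x \<Longrightarrow> P y) \<Longrightarrow> P x"
  shows "P x"
proof -
  obtain t where "transitive_set t" "x \<epsilon> t" by (rule exists_transitive_set)
  then show ?thesis using transitive_set_induct[OF _ assms(1)] assms(2) by blast
qed


section \<open>The action of permutations on the universe\<close>

lemma permutation_appl:
  assumes "permutation \<pi>"
  shows permutation_app: "a \<epsilon> Atoms \<Longrightarrow> app UNIV \<pi> a = appl \<pi> a"
    and permutation_bij: "bij_betw (appl \<pi>) (elts Atoms) (elts Atoms)"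
    and permutation_mem: "a \<epsilon> Atoms \<Longrightarrow> appl \<pi> a \<epsilon> Atoms"
proof -
  have f: "is_function UNIV \<pi> (elts Atoms) (elts Atoms)"
    and b: "bij_betw (app UNIV \<pi>) (elts Atoms) (elts Atoms)"
    using assms by (simp_all add: permutation_def is_bijection_def)
  show eq: "app UNIV \<pi> a = appl \<pi> a" if "a \<epsilon> Atoms" for a
    using app_eq_appl[OF f] that by simp
  show "bij_betw (appl \<pi>) (elts Atoms) (elts Atoms)"
    using b bij_betw_cong[of "elts Atoms" "app UNIV \<pi>" "appl \<pi>"] eq by simp
  show "a \<epsilon> Atoms \<Longrightarrow> appl \<pi> a \<epsilon> Atoms"
    using appl_mem[OF f, of a] by simp
qed

lemma permutation_eqI:
  assumes "permutation \<pi>" "permutation \<sigma>" "\<And>a. a \<epsilon> Atoms \<Longrightarrow> appl \<pi> a = appl \<sigma> a"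
  shows "\<pi> = \<sigma>"
  using assms function_eqI[of \<pi> "elts Atoms" "elts Atoms" \<sigma> "elts Atoms"]
  by (simp add: permutation_def is_bijection_def)

lemma permutation_lam:
  assumes F: "definable_term (\<lambda>e. F (e 0))" and bij: "bij_betw F (elts Atoms) (elts Atoms)"
  shows "permutation (lam Atoms F)"
proof -
  have f: "is_function UNIV (lam Atoms F) (elts Atoms) (elts Atoms)"
    by (rule is_function_lam[OF F]) (use bij_betwE[OF bij] in auto)
  have "app UNIV (lam Atoms F) a = F a" if "a \<in> elts Atoms" for a
    using app_eq_appl[OF f that] appl_lam[OF F] that by simp
  then have "bij_betw (app UNIV (lam Atoms F)) (elts Atoms) (elts Atoms)"
    using bij bij_betw_cong[of "elts Atoms" "app UNIV (lam Atoms F)" F] by simp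
  with f show ?thesis by (simp add: permutation_def is_bijection_def)
qed

text \<open>The multiplication and the unit of \<open>Sym\<close> are both given by a
  \<open>THE\<close> of this shape, so they are instances.\<close>

lemma permutation_the:
  assumes F: "definable_term (\<lambda>e. F (e 0))" and bij: "bij_betw F (elts Atoms) (elts Atoms)"
  defines "\<rho> \<equiv> THE \<rho>. permutation \<rho> \<and> (\<forall>a\<in>elts Atoms. app UNIV \<rho> a = F a)"
  shows "permutation \<rho>" "a \<epsilon> Atoms \<Longrightarrow> appl \<rho> a = F a"
proof -
  have "permutation \<rho> \<and> (\<forall>a\<in>elts Atoms. app UNIV \<rho> a = F a)"
    unfolding \<rho>_def
  proof (rule theI[of _ "lam Atoms F"])
    show "permutation (lam Atoms F) \<and> (\<forall>a\<in>elts Atoms. app UNIV (lam Atoms F) a = F a)"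
      using permutation_lam[OF F bij] permutation_app[OF permutation_lam[OF F bij]] appl_lam[OF F]
      by simp
    fix \<sigma>
    assume "permutation \<sigma> \<and> (\<forall>a\<in>elts Atoms. app UNIV \<sigma> a = F a)"
    then have \<sigma>: "permutation \<sigma>" "\<And>a. a \<epsilon> Atoms \<Longrightarrow> app UNIV \<sigma> a = F a" by simp_all
    show "\<sigma> = lam Atoms F"
      by (rule permutation_eqI[OF \<sigma>(1) permutation_lam[OF F bij]])
        (use \<sigma>(2) permutation_app[OF \<sigma>(1)] in \<open>simp add: appl_lam[OF F]\<close>)
  qed
  then show \<rho>: "permutation \<rho>" and "a \<epsilon> Atoms \<Longrightarrow> appl \<rho> a = F a"
    using permutation_app[of \<rho> a] by simp_all
qed

lemma carrier_Sym [simp]: "\<pi> \<in> carrier Sym \<longleftrightarrow> permutation \<pi>"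
  by (simp add: Sym_def)

lemma Sym_mult:
  assumes "permutation \<pi>" "permutation \<sigma>"
  shows permutation_mult: "permutation (\<pi> \<otimes>\<^bsub>Sym\<^esub> \<sigma>)"
    and appl_mult: "a \<epsilon> Atoms \<Longrightarrow> appl (\<pi> \<otimes>\<^bsub>Sym\<^esub> \<sigma>) a = appl \<pi> (appl \<sigma> a)"
proof -
  have 1: "definable_term (\<lambda>e. appl \<pi> (appl \<sigma> (e 0)))"
    by (intro definable_intros)
  have 2: "bij_betw (\<lambda>a. appl \<pi> (appl \<sigma> a)) (elts Atoms) (elts Atoms)"
    using bij_betw_trans[OF permutation_bij[OF assms(2)] permutation_bij[OF assms(1)]]
    by (simp add: comp_def)
  have "\<pi> \<otimes>\<^bsub>Sym\<^esub> \<sigma> = (THE \<rho>. permutation \<rho> \<and>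
      (\<forall>a\<in>elts Atoms. app UNIV \<rho> a = appl \<pi> (appl \<sigma> a)))"
    using assms by (simp add: Sym_def permutation_app permutation_mem)
  then show "permutation (\<pi> \<otimes>\<^bsub>Sym\<^esub> \<sigma>)"
    "a \<epsilon> Atoms \<Longrightarrow> appl (\<pi> \<otimes>\<^bsub>Sym\<^esub> \<sigma>) a = appl \<pi> (appl \<sigma> a)"
    using permutation_the[OF 1 2] by simp_all
qed

lemma Sym_one:
  shows permutation_one: "permutation \<one>\<^bsub>Sym\<^esub>"
    and appl_one: "a \<epsilon> Atoms \<Longrightarrow> appl \<one>\<^bsub>Sym\<^esub> a = a"
  using permutation_the[of "\<lambda>a. a", OF definable_term_var bij_betw_id[unfolded id_def]]
  by (simp_all add: Sym_def)

lemma group_Sym: "group (Sym :: 'v::zfa monoid)"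
proof (rule groupI)
  fix \<pi> :: 'v assume "\<pi> \<in> carrier Sym"
  then have \<pi>: "permutation \<pi>" by simp
  \<comment> \<open>The inverse is written with \<open>descr\<close> because \<open>lam\<close>
    needs a definable term; on atoms it agrees with \<open>the_inv_into\<close>.\<close>
  let ?F = "\<lambda>a. descr (\<lambda>b. b \<epsilon> Atoms \<and> appl \<pi> b = a)"
  have F: "definable_term (\<lambda>e. ?F (e 0))" by (intro definable_intros)
  have "?F a = the_inv_into (elts Atoms) (appl \<pi>) a" if "a \<in> elts Atoms" for a
  proof (rule descr_eq)
    note b = permutation_bij[OF \<pi>]
    show "the_inv_into (elts Atoms) (appl \<pi>) a \<epsilon> Atoms \<and>
        appl \<pi> (the_inv_into (elts Atoms) (appl \<pi>) a) = a"
      using f_the_inv_into_f_bij_betw[OF b that] bij_betw_apply[OF bij_betw_the_inv_into[OF b] that]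
      by simp
    show "y = the_inv_into (elts Atoms) (appl \<pi>) a" if "y \<epsilon> Atoms \<and> appl \<pi> y = a" for y
      using the_inv_into_f_f[of "appl \<pi>" "elts Atoms" y] b that by (auto simp: bij_betw_def)
  qed
  then have bij: "bij_betw ?F (elts Atoms) (elts Atoms)"
    using bij_betw_the_inv_into[OF permutation_bij[OF \<pi>]]
      bij_betw_cong[of "elts Atoms" ?F "the_inv_into (elts Atoms) (appl \<pi>)" "elts Atoms"] by blast
  have "lam Atoms ?F \<otimes>\<^bsub>Sym\<^esub> \<pi> = \<one>\<^bsub>Sym\<^esub>"
  proof (rule permutation_eqI)
    fix a :: 'v assume a: "a \<epsilon> Atoms"
    have "?F (appl \<pi> a) = a"
      by (rule descr_eq)
        (use a permutation_bij[OF \<pi>] in \<open>auto simp: bij_betw_def dest: inj_onD\<close>)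
    then show "appl (lam Atoms ?F \<otimes>\<^bsub>Sym\<^esub> \<pi>) a = appl \<one>\<^bsub>Sym\<^esub> a"
      using a \<pi> permutation_lam[OF F bij] permutation_mem[OF \<pi> a]
      by (simp add: appl_mult appl_one appl_lam[OF F])
  qed (use \<pi> permutation_lam[OF F bij] in \<open>simp_all add: permutation_mult permutation_one\<close>)
  then show "\<exists>\<sigma>\<in>carrier Sym. \<sigma> \<otimes>\<^bsub>Sym\<^esub> \<pi> = \<one>\<^bsub>Sym\<^esub>"
    using permutation_lam[OF F bij] by auto
next
  fix \<pi> \<sigma> \<rho> :: 'v
  assume \<section>: "\<pi> \<in> carrier Sym" "\<sigma> \<in> carrier Sym" "\<rho> \<in> carrier Sym"
  show "\<pi> \<otimes>\<^bsub>Sym\<^esub> \<sigma> \<otimes>\<^bsub>Sym\<^esub> \<rho> = \<pi> \<otimes>\<^bsub>Sym\<^esub> (\<sigma> \<otimes>\<^bsub>Sym\<^esub> \<rho>)"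
    by (rule permutation_eqI)
      (use \<section> in \<open>simp_all add: permutation_mult appl_mult permutation_mem\<close>)
next
  fix \<pi> :: 'v assume \<pi>: "\<pi> \<in> carrier Sym"
  show "\<one>\<^bsub>Sym\<^esub> \<otimes>\<^bsub>Sym\<^esub> \<pi> = \<pi>"
    by (rule permutation_eqI)
      (use \<pi> in \<open>simp_all add: permutation_mult permutation_one appl_mult appl_one permutation_mem\<close>)
qed (simp_all add: permutation_mult permutation_one)

interpretation Sym: group "Sym :: 'v::zfa monoid"
  by (rule group_Sym)

section \<open>Extension of permutations by recursion\<close>

definition recursion_act :: "'v::zfa \<Rightarrow> 'v \<Rightarrow> 'v \<Rightarrow> bool" where
  "recursion_act \<pi> t f \<longleftrightarrow> transitive_set t \<and>
     (\<forall>z\<in>elts t. appl f z = (if is_set z then img f z else appl \<pi> z))"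

text \<open>Agrees with \<open>act\<close> for permutations, but is definable in both arguments: the value of \<open>THE\<close>
  in \<open>act\<close> is unspecified for other \<open>\<pi>\<close>.\<close>

definition act' :: "'v::zfa \<Rightarrow> 'v \<Rightarrow> 'v" where
  "act' \<pi> x = descr (\<lambda>y. \<exists>t f. recursion_act \<pi> t f \<and> x \<epsilon> t \<and> y = appl f x)"

lemma definable_term_act' [definable_intros]:
  "definable_term s \<Longrightarrow> definable_term t \<Longrightarrow> definable_term (\<lambda>e. act' (s e) (t e))"
  by (rule definable_term_subst2) (simp_all add: act'_def recursion_act_def, intro definable_intros)

lemma recursion_act_unique:
  assumes f: "recursion_act \<pi> s f" and g: "recursion_act \<pi> t g" and "x \<epsilon> s" "x \<epsilon> t"
  shows "appl f x = appl g x"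
proof -
  have "x \<epsilon> t \<longrightarrow> appl f x = appl g x"
  proof (rule transitive_set_induct[of s _ x])
    show "definable (\<lambda>e. e 0 \<epsilon> t \<longrightarrow> appl f (e 0) = appl g (e 0))" by (intro definable_intros)
    fix x assume x: "x \<epsilon> s" "\<And>y. y \<epsilon> x \<Longrightarrow> y \<epsilon> t \<longrightarrow> appl f y = appl g y"
    show "x \<epsilon> t \<longrightarrow> appl f x = appl g x"
    proof
      assume t: "x \<epsilon> t"
      then have "appl f y = appl g y" if "y \<epsilon> x" for y
        using x(2)[OF that] g that transitive_setD unfolding recursion_act_def by blast
      then have "img f x = img g x"
        by (intro is_set_eqI) (auto simp: img)
      then show "appl f x = appl g x"
        using f g t x(1) by (simp add: recursion_act_def)
    qed
  qed (use assms in \<open>simp_all add: recursion_act_def\<close>)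
  then show ?thesis using assms by simp
qed

lemma act'_eq:
  assumes "recursion_act \<pi> t f" "x \<epsilon> t"
  shows "act' \<pi> x = appl f x"
  unfolding act'_def by (rule descr_eq) (use assms recursion_act_unique in blast)+

lemma exists_recursion_act:
  obtains t f where "x \<epsilon> t" "recursion_act \<pi> t f" "is_function UNIV f (elts t) UNIV"
proof -
  obtain t where t: "transitive_set t" "x \<epsilon> t" by (rule exists_transitive_set)
  have "definable_term (\<lambda>e. if is_set (e 0) then e 1 else appl \<pi> (e 0))"
    by (intro definable_intros)
  from transitive_set_recursion[OF this t(1)] obtain f where "is_function UNIV f (elts t) UNIV"
    "\<And>z. z \<epsilon> t \<Longrightarrow> appl f z = (if is_set z then img f z else appl \<pi> z)" by blast
  then show ?thesis using that[of t f] t by (simp add: recursion_act_def)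
qed

text \<open>For a permutation, \<open>app\<close> and \<open>appl\<close> agree on atoms, so the
  conditions in \<open>act\<close> become those of \<open>recursion_act\<close>, whose solutions
  have a unique value at \<open>x\<close>.\<close>

lemma act_eq_act':
  assumes \<pi>: "permutation \<pi>"
  shows "act \<pi> x = act' \<pi> x"
proof -
  have iff: "(transitive_set t \<and> x \<epsilon> t \<and> is_function UNIV f (elts t) UNIV \<and>
     (\<forall>z\<in>elts t. if is_set z
        then is_set (app UNIV f z) \<and> elts (app UNIV f z) = app UNIV f ` elts z
        else app UNIV f z = app UNIV \<pi> z) \<and> y = app UNIV f x) \<longleftrightarrow>
     (recursion_act \<pi> t f \<and> x \<epsilon> t \<and> is_function UNIV f (elts t) UNIV \<and> y = appl f x)" for t f y
  proof (cases "transitive_set t \<and> x \<epsilon> t \<and> is_function UNIV f (elts t) UNIV")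
    case True
    then have app: "app UNIV f z = appl f z" if "z \<epsilon> t" for z
      using app_eq_appl[of f "elts t" UNIV z] that by simp
    have "app UNIV f ` elts z = appl f ` elts z" if "z \<epsilon> t" for z
      using True that app transitive_setD[of t] by (intro image_cong) auto
    moreover have "is_set u \<and> elts u = appl f ` elts z \<longleftrightarrow> u = img f z" for u z
    proof -
      have "elts (img f z) = appl f ` elts z" by (auto simp: img)
      then show ?thesis using extensionality[of u "img f z"] img(1) by metis
    qed
    moreover have "app UNIV \<pi> z = appl \<pi> z" if "\<not> is_set z" for z
      using permutation_app[OF \<pi>] that by (simp add: is_set_def)
    ultimately have "(if is_set z
        then is_set (app UNIV f z) \<and> elts (app UNIV f z) = app UNIV f ` elts z
        else app UNIV f z = app UNIV \<pi> z) \<longleftrightarrow> appl f z = (if is_set z then img f z else appl \<pi> z)"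
      if "z \<epsilon> t" for z using that app by simp
    then show ?thesis
      using True app by (simp add: recursion_act_def)
  qed (auto simp: recursion_act_def)
  obtain t f where tf: "x \<epsilon> t" "recursion_act \<pi> t f" "is_function UNIV f (elts t) UNIV"
    by (rule exists_recursion_act)
  show ?thesis
    unfolding act_def iff
  proof (rule the_equality)
    show "\<exists>t f. recursion_act \<pi> t f \<and> x \<epsilon> t \<and> is_function UNIV f (elts t) UNIV \<and> act' \<pi> x = appl f x"
      using tf act'_eq[OF tf(2,1)] by blast
  qed (use act'_eq in metis)
qed

lemma act'_simps:
  shows act'_atom: "\<not> is_set x \<Longrightarrow> act' \<pi> x = appl \<pi> x"
    and is_set_act': "is_set x \<Longrightarrow> is_set (act' \<pi> x)"
    and mem_act': "is_set x \<Longrightarrow> u \<epsilon> act' \<pi> x \<longleftrightarrow> (\<exists>y. y \<epsilon> x \<and> u = act' \<pi> y)"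
proof -
  obtain t f where tf: "x \<epsilon> t" "recursion_act \<pi> t f"
    using exists_recursion_act by metis
  then have "act' \<pi> y = appl f y" if "y \<epsilon> x" for y
    using that act'_eq[OF tf(2)] transitive_setD unfolding recursion_act_def by blast
  then show "\<not> is_set x \<Longrightarrow> act' \<pi> x = appl \<pi> x" "is_set x \<Longrightarrow> is_set (act' \<pi> x)"
    "is_set x \<Longrightarrow> u \<epsilon> act' \<pi> x \<longleftrightarrow> (\<exists>y. y \<epsilon> x \<and> u = act' \<pi> y)"
    using act'_eq[OF tf(2,1)] tf by (auto simp: recursion_act_def img)
qed

lemma not_is_set: "\<not> is_set x \<Longrightarrow> \<not> u \<epsilon> (x::'v::zfa)"
  using atoms[of x] by (auto simp: is_set_def elts_in_def)

text \<open>The rule for elements needs no case distinction: a permutation sends atoms to atoms, and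
  atoms have no elements.\<close>

lemma act:
  assumes \<pi>: "permutation \<pi>"
  shows act_atom: "\<not> is_set x \<Longrightarrow> act \<pi> x = appl \<pi> x"
    and is_set_act: "is_set (act \<pi> x) \<longleftrightarrow> is_set x"
    and mem_act: "u \<epsilon> act \<pi> x \<longleftrightarrow> (\<exists>y. y \<epsilon> x \<and> u = act \<pi> y)"
proof -
  note [simp] = act_eq_act'[OF \<pi>]
  show "act \<pi> x = appl \<pi> x" if "\<not> is_set x"
    using that by (simp add: act'_atom)
  have atom: "\<not> is_set (act \<pi> x)" if "\<not> is_set x"
    using that permutation_mem[OF \<pi>] by (simp add: act'_atom is_set_def)
  then show "is_set (act \<pi> x) \<longleftrightarrow> is_set x"
    using is_set_act'[of x \<pi>] by auto
  show "u \<epsilon> act \<pi> x \<longleftrightarrow> (\<exists>y. y \<epsilon> x \<and> u = act \<pi> y)"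
    using mem_act'[of x u \<pi>] atom not_is_set[of x] not_is_set[of "act \<pi> x"] by (cases "is_set x") auto
qed

lemma act_mult:
  assumes \<pi>: "permutation \<pi>" and \<sigma>: "permutation \<sigma>"
  shows "act (\<pi> \<otimes>\<^bsub>Sym\<^esub> \<sigma>) x = act \<pi> (act \<sigma> x)"
proof (rule mem_induct[of "\<lambda>x. act (\<pi> \<otimes>\<^bsub>Sym\<^esub> \<sigma>) x = act \<pi> (act \<sigma> x)"])
  note \<rho> = permutation_mult[OF \<pi> \<sigma>]
  show "definable (\<lambda>e. act (\<pi> \<otimes>\<^bsub>Sym\<^esub> \<sigma>) (e 0) = act \<pi> (act \<sigma> (e 0)))"
    unfolding act_eq_act'[OF \<pi>] act_eq_act'[OF \<sigma>] act_eq_act'[OF \<rho>]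
    by (intro definable_intros)
  fix x assume IH: "\<And>y. y \<epsilon> x \<Longrightarrow> act (\<pi> \<otimes>\<^bsub>Sym\<^esub> \<sigma>) y = act \<pi> (act \<sigma> y)"
  show "act (\<pi> \<otimes>\<^bsub>Sym\<^esub> \<sigma>) x = act \<pi> (act \<sigma> x)"
  proof (cases "is_set x")
    case True
    then show ?thesis
      using IH \<pi> \<sigma> \<rho> by (intro is_set_eqI) (auto simp: is_set_act mem_act)
  next
    case False
    then have "x \<epsilon> Atoms" "\<not> is_set (appl \<sigma> x)"
      using permutation_mem[OF \<sigma>] by (simp_all add: is_set_def)
    then show ?thesis
      using False \<pi> \<sigma> \<rho> by (simp add: act_atom appl_mult)
  qed
qed

lemma act_one: "act \<one>\<^bsub>Sym\<^esub> x = (x::'v::zfa)"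
proof (rule mem_induct[of "\<lambda>x. act \<one>\<^bsub>Sym\<^esub> x = x"])
  show "definable (\<lambda>e::nat \<Rightarrow> 'v. act \<one>\<^bsub>Sym\<^esub> (e 0) = e 0)"
    unfolding act_eq_act'[OF permutation_one] by (intro definable_intros)
  fix x :: 'v assume IH: "\<And>y. y \<epsilon> x \<Longrightarrow> act \<one>\<^bsub>Sym\<^esub> y = y"
  show "act \<one>\<^bsub>Sym\<^esub> x = x"
  proof (cases "is_set x")
    case True
    then show ?thesis
      using IH by (intro is_set_eqI) (auto simp: is_set_act mem_act permutation_one)
  next
    case False
    then show ?thesis by (simp add: permutation_one act_atom appl_one is_set_def)
  qed
qed

lemma permutation_inv: "permutation \<pi> \<Longrightarrow> permutation (inv\<^bsub>Sym\<^esub> \<pi>)"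
  using Sym.inv_closed[of \<pi>] by simp

lemma act_inv:
  assumes "permutation \<pi>"
  shows act_inv_act: "act (inv\<^bsub>Sym\<^esub> \<pi>) (act \<pi> x) = x"
    and act_act_inv: "act \<pi> (act (inv\<^bsub>Sym\<^esub> \<pi>) x) = x"
  using act_mult[OF permutation_inv[OF assms] assms, of x]
    act_mult[OF assms permutation_inv[OF assms], of x] assms
  by (simp_all add: act_one)

lemma act_inject: "permutation \<pi> \<Longrightarrow> act \<pi> x = act \<pi> y \<longleftrightarrow> x = y"
  using act_inv_act by metis

lemma act_mem_act: "permutation \<pi> \<Longrightarrow> act \<pi> x \<epsilon> act \<pi> y \<longleftrightarrow> x \<epsilon> y"
  by (auto simp: mem_act act_inject)

lemma act_eqI:
  assumes "permutation \<pi>" "is_set x" "is_set y" "\<And>u. act \<pi> u \<epsilon> y \<longleftrightarrow> u \<epsilon> x"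
  shows "act \<pi> x = y"
proof (rule is_set_eqI)
  show "u \<epsilon> act \<pi> x \<longleftrightarrow> u \<epsilon> y" for u
    using assms(4)[of "act (inv\<^bsub>Sym\<^esub> \<pi>) u"] act_mem_act[OF assms(1), of "act (inv\<^bsub>Sym\<^esub> \<pi>) u" x]
    by (simp add: act_act_inv[OF assms(1)])
qed (use assms in \<open>simp_all add: is_set_act\<close>)

lemma act_upair: "permutation \<pi> \<Longrightarrow> act \<pi> (upair x y) = upair (act \<pi> x) (act \<pi> y)"
  by (rule act_eqI) (simp_all add: act_inject)

lemma act_opair: "permutation \<pi> \<Longrightarrow> act \<pi> (opair x y) = opair (act \<pi> x) (act \<pi> y)"
  by (simp add: opair_def act_upair)

section \<open>Hereditarily symmetric objects\<close>

text \<open>Invariance under \<open>\<pi>\<close> alone yields only an inclusion; invariance under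
  the inverse yields the converse one.\<close>

lemma act_fixI:
  assumes \<pi>: "permutation \<pi>" and "is_set x"
    and "\<And>u. u \<epsilon> x \<Longrightarrow> act \<pi> u \<epsilon> x" "\<And>u. u \<epsilon> x \<Longrightarrow> act (inv\<^bsub>Sym\<^esub> \<pi>) u \<epsilon> x"
  shows "act \<pi> x = x"
  by (rule act_eqI[OF \<pi>]) (use assms act_inv_act[OF \<pi>] in \<open>auto; metis\<close>)+

lemma act_pointwise_fixed:
  assumes "permutation \<pi>" "is_set x" "\<And>u. u \<epsilon> x \<Longrightarrow> act \<pi> u = u"
  shows "act \<pi> x = x"
  by (rule is_set_eqI) (use assms in \<open>auto simp: is_set_act mem_act\<close>)

lemma elts_subset_transitive_closure: "y \<epsilon> x \<Longrightarrow> y \<in> transitive_closure x"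
  by (auto simp: transitive_closure_def)

lemma transitive_closure_mem: "u \<epsilon> y \<Longrightarrow> y \<in> transitive_closure x \<Longrightarrow> u \<in> transitive_closure x"
  unfolding transitive_closure_def using transitive_setD by blast

lemma transitive_closure_subset: "y \<epsilon> x \<Longrightarrow> transitive_closure y \<subseteq> transitive_closure x"
proof -
  have "elts y \<subseteq> elts t" if "y \<epsilon> x" "transitive_set t" "elts x \<subseteq> elts t" for t
    using that by (auto simp: transitive_set_def)
  then show "y \<epsilon> x \<Longrightarrow> transitive_closure y \<subseteq> transitive_closure x"
    unfolding transitive_closure_def by blast
qed

text \<open>The points that are elements of \<open>x\<close> or lie in the closure of such an
  element form a transitive set, so they include the whole closure of \<open>x\<close>.\<close>

lemma transitive_closure_cases:
  assumes "y \<in> transitive_closure x"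
  obtains "y \<epsilon> x" | z where "z \<epsilon> x" "y \<in> transitive_closure z"
proof -
  obtain t where t: "transitive_set t" "x \<epsilon> t" by (rule exists_transitive_set)
  \<comment> \<open>\<open>transitive_closure\<close> is a HOL set; spelled out as a condition on
    all transitive sets, membership in it becomes first-order.\<close>
  have "definable (\<lambda>e. e 0 \<epsilon> x \<or> (\<exists>z\<in>elts x. \<forall>t.
      transitive_set t \<and> (\<forall>u\<in>elts z. u \<epsilon> t) \<longrightarrow> e 0 \<epsilon> t))"
    by (intro definable_intros)
  then have "definable (\<lambda>e. e 0 \<epsilon> x \<or> (\<exists>z\<in>elts x. e 0 \<in> transitive_closure z))"
    by (simp add: transitive_closure_def subset_eq)
  from small_separation[OF this, of t] obtain s where s: "is_set s"
    "\<And>u. u \<epsilon> s \<longleftrightarrow> u \<epsilon> t \<and> (u \<epsilon> x \<or> (\<exists>z\<in>elts x. u \<in> transitive_closure z))"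
    by (rule smallE) simp
  have "u \<epsilon> s" if "v \<epsilon> s" "u \<epsilon> v" for u v
  proof -
    have "u \<epsilon> t" using that s(2) transitive_setD[OF t(1)] by blast
    moreover have "\<exists>z\<in>elts x. u \<in> transitive_closure z"
      using that s(2) elts_subset_transitive_closure transitive_closure_mem by (metis mem_elts_iff)
    ultimately show ?thesis using s(2) by blast
  qed
  then have "transitive_set s" using s(1) unfolding transitive_set_iff by blast
  moreover have "elts x \<subseteq> elts s"
    using transitive_setD[OF t(1) _ t(2)] s(2) by auto
  ultimately have "y \<epsilon> s" using assms by (auto simp: transitive_closure_def)
  then show ?thesis using s(2) that by auto
qed

section \<open>Stabilizers and the normal filter\<close>

locale permutation_model =
  fixes \<G> \<F> :: "'v::zfa"
  assumes group: "permutation_group \<G>" and filter: "normal_filter \<F> \<G>"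
begin

lemma subgroup_\<G>: "subgroup (elts \<G>) Sym"
  using group by (simp add: permutation_group_def)

lemma \<G>_simps [simp]:
  shows permutation_\<G>: "\<pi> \<epsilon> \<G> \<Longrightarrow> permutation \<pi>"
    and inv_\<G>: "\<pi> \<epsilon> \<G> \<Longrightarrow> inv\<^bsub>Sym\<^esub> \<pi> \<epsilon> \<G>"
    and mult_\<G>: "\<pi> \<epsilon> \<G> \<Longrightarrow> \<sigma> \<epsilon> \<G> \<Longrightarrow> \<pi> \<otimes>\<^bsub>Sym\<^esub> \<sigma> \<epsilon> \<G>"
  using subgroup.mem_carrier[OF subgroup_\<G>, of \<pi>] subgroup.m_inv_closed[OF subgroup_\<G>, of \<pi>]
    subgroup.m_closed[OF subgroup_\<G>, of \<pi> \<sigma>] by auto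

lemma filter_subgroup:
  assumes "H \<epsilon> \<F>"
  shows filter_is_set: "is_set H"
    and filter_mem_\<G>: "\<pi> \<epsilon> H \<Longrightarrow> \<pi> \<epsilon> \<G>"
    and filter_inv: "\<pi> \<epsilon> H \<Longrightarrow> inv\<^bsub>Sym\<^esub> \<pi> \<epsilon> H"
    and filter_mult: "\<pi> \<epsilon> H \<Longrightarrow> \<sigma> \<epsilon> H \<Longrightarrow> \<pi> \<otimes>\<^bsub>Sym\<^esub> \<sigma> \<epsilon> H"
proof -
  have *: "subgroup_of H \<G>"
    using assms filter by (simp add: normal_filter_def)
  then have "subgroup (elts H) Sym"
    by (simp add: subgroup_of_def permutation_group_def)
  then show "\<pi> \<epsilon> H \<Longrightarrow> inv\<^bsub>Sym\<^esub> \<pi> \<epsilon> H" "\<pi> \<epsilon> H \<Longrightarrow> \<sigma> \<epsilon> H \<Longrightarrow> \<pi> \<otimes>\<^bsub>Sym\<^esub> \<sigma> \<epsilon> H"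
    using subgroup.m_inv_closed[of "elts H" Sym \<pi>] subgroup.m_closed[of "elts H" Sym \<pi> \<sigma>] by auto
  show "is_set H" "\<pi> \<epsilon> H \<Longrightarrow> \<pi> \<epsilon> \<G>"
    using * by (auto simp: subgroup_of_def permutation_group_def)
qed

lemma filter_nonempty: obtains H where "H \<epsilon> \<F>"
  using filter by (auto simp: normal_filter_def)

lemma filter_Int:
  assumes "H \<epsilon> \<F>" "K \<epsilon> \<F>"
  obtains L where "L \<epsilon> \<F>" "\<And>\<pi>. \<pi> \<epsilon> L \<longleftrightarrow> \<pi> \<epsilon> H \<and> \<pi> \<epsilon> K"
proof -
  obtain L where "L \<in> elts \<F>" "elts L = elts H \<inter> elts K"
    using assms filter unfolding normal_filter_def by (metis mem_elts_iff)
  then show ?thesis using that[of L] by (auto simp: set_eq_iff)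
qed

text \<open>The group sym(x) as a set of the universe. Separation requires the definable
  \<open>act'\<close>, which agrees with \<open>act\<close> on \<open>\<G>\<close>.\<close>

definition stab :: "'v \<Rightarrow> 'v" where
  "stab x = Coll (\<lambda>\<pi>. \<pi> \<epsilon> \<G> \<and> act' \<pi> x = x)"

lemma definable_term_stab:
  "definable_term t \<Longrightarrow> definable_term (\<lambda>e. stab (t e))"
  by (rule definable_term_subst1) (simp_all add: stab_def, intro definable_intros)

lemma is_set_stab: "is_set (stab x)"
  and mem_stab: "\<pi> \<epsilon> stab x \<longleftrightarrow> \<pi> \<epsilon> \<G> \<and> act \<pi> x = x"
proof -
  have s: "small {\<pi>. \<pi> \<epsilon> \<G> \<and> act' \<pi> x = x}"
    by (rule small_separation) (intro definable_intros)
  show "is_set (stab x)" unfolding stab_def by (rule is_set_Coll[OF s])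
  show "\<pi> \<epsilon> stab x \<longleftrightarrow> \<pi> \<epsilon> \<G> \<and> act \<pi> x = x"
    unfolding stab_def mem_Coll[OF s] by (auto simp: act_eq_act')
qed

lemma subgroup_of_stab: "subgroup_of (stab x) \<G>"
proof -
  have "subgroup (elts (stab x)) Sym"
  proof (rule Sym.subgroupI)
    show "elts (stab x) \<subseteq> carrier Sym" by (auto simp: mem_stab)
    have "\<one>\<^bsub>Sym\<^esub> \<epsilon> \<G>" using subgroup.one_closed[OF subgroup_\<G>] by simp
    then show "elts (stab x) \<noteq> {}" using act_one[of x] mem_stab by auto
    show "inv\<^bsub>Sym\<^esub> \<pi> \<in> elts (stab x)" if "\<pi> \<in> elts (stab x)" for \<pi>
      using that act_inv_act[of \<pi> x] by (auto simp: mem_stab)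
    show "\<pi> \<otimes>\<^bsub>Sym\<^esub> \<sigma> \<in> elts (stab x)" if "\<pi> \<in> elts (stab x)" "\<sigma> \<in> elts (stab x)" for \<pi> \<sigma>
      using that by (auto simp: mem_stab act_mult)
  qed
  then show ?thesis
    by (auto simp: subgroup_of_def permutation_group_def is_set_stab mem_stab)
qed

lemma symmetric_iff: "symmetric \<G> \<F> x \<longleftrightarrow> stab x \<epsilon> \<F>"
proof
  assume "symmetric \<G> \<F> x"
  then obtain H where H: "H \<epsilon> \<F>" "elts H = {\<pi> \<in> elts \<G>. act \<pi> x = x}"
    by (auto simp: symmetric_def)
  have "\<pi> \<epsilon> H \<longleftrightarrow> \<pi> \<epsilon> stab x" for \<pi>
  proof -
    have "\<pi> \<in> elts H \<longleftrightarrow> \<pi> \<in> {\<pi> \<in> elts \<G>. act \<pi> x = x}" by (simp only: H(2))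
    then show ?thesis by (simp add: mem_stab)
  qed
  then have "H = stab x"
    by (intro is_set_eqI filter_is_set[OF H(1)] is_set_stab)
  then show "stab x \<epsilon> \<F>" using H(1) by simp
next
  assume "stab x \<epsilon> \<F>"
  then show "symmetric \<G> \<F> x"
    unfolding symmetric_def by (intro bexI[of _ "stab x"]) (auto simp: mem_stab)
qed

text \<open>The stabilizer of \<open>x\<close> is a supergroup of \<open>H\<close>, and the filter
  is closed under supergroups.\<close>

lemma symmetricI:
  assumes "H \<epsilon> \<F>" "\<And>\<pi>. \<pi> \<epsilon> H \<Longrightarrow> act \<pi> x = x"
  shows "symmetric \<G> \<F> x"
proof -
  have "elts H \<subseteq> elts (stab x)"
    using assms filter_mem_\<G> by (auto simp: mem_stab)
  moreover have "\<forall>K. subgroup_of K \<G> \<and> elts H \<subseteq> elts K \<longrightarrow> K \<epsilon> \<F>"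
    using filter assms(1) unfolding normal_filter_def by blast
  ultimately show ?thesis
    using subgroup_of_stab unfolding symmetric_iff by blast
qed

lemma symmetricE:
  assumes "symmetric \<G> \<F> x"
  obtains H where "H \<epsilon> \<F>" "\<And>\<pi>. \<pi> \<epsilon> H \<Longrightarrow> act \<pi> x = x"
  using assms that[of "stab x"] by (simp add: symmetric_iff mem_stab)

text \<open>The conjugate of \<open>H\<close> by \<open>\<pi>\<close> fixes the image under
  \<open>\<pi>\<close> of whatever \<open>H\<close> fixes. It does not depend on \<open>x\<close>,
  so one subgroup serves a whole family of objects.\<close>

lemma filter_conjugate:
  assumes "H \<epsilon> \<F>" "\<pi> \<epsilon> \<G>"
  obtains L where "L \<epsilon> \<F>"
    "\<And>\<sigma> x. \<sigma> \<epsilon> L \<Longrightarrow> (\<And>h. h \<epsilon> H \<Longrightarrow> act h x = x) \<Longrightarrow> act \<sigma> (act \<pi> x) = act \<pi> x"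
proof -
  obtain L where L: "L \<in> elts \<F>" "elts L = conjugate \<pi> (elts H)"
    using assms filter unfolding normal_filter_def by (metis mem_elts_iff)
  have "act \<sigma> (act \<pi> x) = act \<pi> x" if \<sigma>: "\<sigma> \<epsilon> L" and h: "\<And>h. h \<epsilon> H \<Longrightarrow> act h x = x" for \<sigma> x
  proof -
    have "\<sigma> \<in> conjugate \<pi> (elts H)" using \<sigma> L(2) by auto
    then obtain h where "h \<epsilon> H" "\<sigma> = \<pi> \<otimes>\<^bsub>Sym\<^esub> h \<otimes>\<^bsub>Sym\<^esub> inv\<^bsub>Sym\<^esub> \<pi>"
      by (auto simp: conjugate_def)
    then show ?thesis
      using h[of h] assms filter_mem_\<G>[OF assms(1)]
      by (simp add: act_mult act_inv_act permutation_mult)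
  qed
  then show ?thesis using that L(1) by simp
qed

lemma mem_conjugate_stab:
  assumes "\<sigma> \<epsilon> \<G>" "\<pi> \<in> conjugate \<sigma> (elts (stab x))"
  shows "act \<pi> (act \<sigma> x) = act \<sigma> x"
proof -
  obtain h where "h \<epsilon> stab x" "\<pi> = \<sigma> \<otimes>\<^bsub>Sym\<^esub> h \<otimes>\<^bsub>Sym\<^esub> inv\<^bsub>Sym\<^esub> \<sigma>"
    using assms(2) by (auto simp: conjugate_def)
  then show ?thesis
    using assms(1) by (simp add: act_mult act_inv_act permutation_mult mem_stab)
qed

section \<open>Absoluteness for the permutation model\<close>

abbreviation M :: "'v set" where "M \<equiv> HS \<G> \<F>"

lemma HS_symmetric: "x \<in> M \<Longrightarrow> symmetric \<G> \<F> x"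
  by (simp add: HS_def)

lemma HS_mem: "x \<in> M \<Longrightarrow> y \<epsilon> x \<Longrightarrow> y \<in> M"
  using elts_subset_transitive_closure transitive_closure_subset by (fastforce simp: HS_def)

lemma HSI:
  assumes "symmetric \<G> \<F> x" "\<And>y. y \<epsilon> x \<Longrightarrow> y \<in> M"
  shows "x \<in> M"
proof -
  have "symmetric \<G> \<F> y" if "y \<in> transitive_closure x" for y
    using that by (cases rule: transitive_closure_cases) (use assms(2) in \<open>auto simp: HS_def\<close>)
  then show ?thesis using assms(1) by (simp add: HS_def)
qed

lemma HS_upair:
  assumes "x \<in> M" "y \<in> M" shows "upair x y \<in> M"
proof (rule HSI)
  obtain H K where HK: "H \<epsilon> \<F>" "\<And>\<pi>. \<pi> \<epsilon> H \<Longrightarrow> act \<pi> x = x" "K \<epsilon> \<F>" "\<And>\<pi>. \<pi> \<epsilon> K \<Longrightarrow> act \<pi> y = y"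
    using assms[THEN HS_symmetric] symmetricE by metis
  obtain L where L: "L \<epsilon> \<F>" "\<And>\<pi>. \<pi> \<epsilon> L \<longleftrightarrow> \<pi> \<epsilon> H \<and> \<pi> \<epsilon> K"
    using filter_Int[OF HK(1,3)] by blast
  show "symmetric \<G> \<F> (upair x y)"
    by (rule symmetricI[OF L(1)])
      (use HK L filter_mem_\<G>[OF L(1)] in \<open>simp add: act_upair\<close>)
qed (use assms in auto)

lemma HS_opair [simp]: "opair x y \<in> M \<longleftrightarrow> x \<in> M \<and> y \<in> M"
proof
  assume *: "opair x y \<in> M"
  have "upair x y \<in> M" by (rule HS_mem[OF *]) (simp add: opair_def)
  then show "x \<in> M \<and> y \<in> M" using HS_mem[of "upair x y"] by simp
qed (simp add: opair_def HS_upair)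

lemma elts_HS: "x \<in> M \<Longrightarrow> elts_in M x = elts x"
  using HS_mem by (auto simp: elts_in_def)

lemma is_upair_HS: "z \<in> M \<Longrightarrow> x \<in> M \<Longrightarrow> y \<in> M \<Longrightarrow> is_upair M z x y \<longleftrightarrow> z = upair x y"
proof -
  assume M: "z \<in> M" "x \<in> M" "y \<in> M"
  then have "(\<forall>w\<in>M. w \<epsilon> z \<longleftrightarrow> w = x \<or> w = y) \<longleftrightarrow> (\<forall>w. w \<epsilon> z \<longleftrightarrow> w = x \<or> w = y)"
    using HS_mem by blast
  then show ?thesis using is_upair_UNIV[of z x y] by (simp add: is_upair_def)
qed

lemma is_pair_HS: "p \<in> M \<Longrightarrow> x \<in> M \<Longrightarrow> y \<in> M \<Longrightarrow> is_pair M p x y \<longleftrightarrow> p = opair x y"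
  by (auto simp: is_pair_def is_upair_HS opair_def HS_upair)

lemma rel_HS: "x \<in> M \<Longrightarrow> y \<in> M \<Longrightarrow> rel M r x y \<longleftrightarrow> opair x y \<epsilon> r"
  by (auto simp: rel_def is_pair_HS)

text \<open>All arguments and values of \<open>f\<close> lie in the model, so restricting the
  quantifiers to \<open>M\<close> changes neither the pairs nor the value picked by
  \<open>THE\<close>.\<close>

lemma is_bijection_HS:
  assumes f: "f \<in> M" and X: "X \<subseteq> M" and Y: "Y \<subseteq> M"
    and bij: "is_bijection UNIV f X Y"
  shows "is_bijection M f X Y" "x \<in> X \<Longrightarrow> app M f x = appl f x"
proof -
  have fn: "is_function UNIV f X Y" and b: "bij_betw (app UNIV f) X Y"
    using bij by (simp_all add: is_bijection_def)
  have mem: "y \<in> M \<and> rel M f x y \<longleftrightarrow> y = appl f x" if "x \<in> X" for x y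
    using opair_mem_function[OF fn that] appl_mem[OF fn that] that X Y rel_HS[of x y f] by auto
  show app: "app M f x = appl f x" if "x \<in> X" for x
    unfolding app_def mem[OF that] by simp
  have "\<exists>x\<in>X. \<exists>y\<in>Y. is_pair M p x y" if "p \<in> elts_in M f" for p
  proof -
    have "p \<epsilon> f" "p \<in> M" using that by (simp_all add: elts_in_def)
    then obtain x where "x \<in> X" "p = opair x (appl f x)" using mem_function[OF fn] by blast
    then show ?thesis
      using \<open>p \<in> M\<close> appl_mem[OF fn \<open>x \<in> X\<close>] X Y is_pair_HS[of p x "appl f x"] by auto
  qed
  moreover have "\<exists>!y. y \<in> M \<and> rel M f x y" if "x \<in> X" for x
    unfolding mem[OF that] by simp
  ultimately have "is_function M f X Y"
    using fn by (simp add: is_function_def)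
  moreover have "bij_betw (app M f) X Y"
    using b bij_betw_cong[of X "app M f" "app UNIV f" Y] app app_eq_appl[OF fn] by simp
  ultimately show "is_bijection M f X Y" by (simp add: is_bijection_def)
qed

lemma rel_HS_on:
  assumes "X \<subseteq> M"
  shows "irreflp_on X (rel M r) \<longleftrightarrow> irreflp_on X (rel UNIV r)"
    and "transp_on X (rel M r) \<longleftrightarrow> transp_on X (rel UNIV r)"
    and "totalp_on X (rel M r) \<longleftrightarrow> totalp_on X (rel UNIV r)"
proof -
  have "rel M r x y \<longleftrightarrow> rel UNIV r x y" if "x \<in> X" "y \<in> X" for x y
    using rel_HS that assms by auto
  then show "irreflp_on X (rel M r) \<longleftrightarrow> irreflp_on X (rel UNIV r)"
    "transp_on X (rel M r) \<longleftrightarrow> transp_on X (rel UNIV r)"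
    "totalp_on X (rel M r) \<longleftrightarrow> totalp_on X (rel UNIV r)"
    unfolding irreflp_on_def transp_on_def totalp_on_def by meson+
qed

text \<open>The set of points moved by \<open>H\<close> is invariant under \<open>H\<close>, so it belongs to the model. Its
  least element would have to be fixed by \<open>H\<close>; hence \<open>H\<close> fixes all points and every subset that
  exists in the universe belongs to the model.\<close>

lemma well_ordered_UNIV:
  assumes H: "H \<epsilon> \<F>" and X: "small X" "X \<subseteq> M"
    and inv: "\<And>\<pi> x. \<pi> \<epsilon> H \<Longrightarrow> x \<in> X \<Longrightarrow> act \<pi> x \<in> X"
    and R: "\<And>\<pi>. \<pi> \<epsilon> H \<Longrightarrow> act \<pi> R = R"
    and wo: "well_ordered M X (rel M R)"
  shows "well_ordered UNIV X (rel UNIV R)"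
proof -
  have irrefl: "irreflp_on X (rel UNIV R)" and trans: "transp_on X (rel UNIV R)"
    and total: "totalp_on X (rel UNIV R)"
    using wo rel_HS_on[OF X(2)] by (simp_all add: well_ordered_def)
  have least: "\<exists>m. m \<epsilon> Y \<and> (\<forall>y. y \<epsilon> Y \<longrightarrow> y = m \<or> opair m y \<epsilon> R)"
    if Y: "is_set Y" "Y \<in> M" "\<And>y. y \<epsilon> Y \<Longrightarrow> y \<in> X" "y \<epsilon> Y" for Y y
  proof -
    have "\<exists>m\<in>elts_in M Y. \<forall>y\<in>elts_in M Y. y = m \<or> rel M R m y"
      using wo Y unfolding well_ordered_def elts_HS[OF Y(2)] by (metis elts_HS empty_iff mem_elts_iff subsetI)
    then show ?thesis
      using Y X(2) rel_HS unfolding elts_HS[OF Y(2)] by (metis mem_elts_iff subsetD)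
  qed
  note [simp] = filter_mem_\<G>[OF H] filter_inv[OF H] filter_mult[OF H]
  have "definable (\<lambda>e. \<exists>\<pi>\<in>elts H. act' \<pi> (e 0) \<noteq> e 0)"
    by (intro definable_intros)
  then have "small {x. x \<in> X \<and> (\<exists>\<pi>\<in>elts H. act' \<pi> x \<noteq> x)}"
    by (rule small_Collect_conj[OF X(1)])
  then obtain Y where Y: "is_set Y" "\<And>x. x \<epsilon> Y \<longleftrightarrow> x \<in> X \<and> (\<exists>\<pi>. \<pi> \<epsilon> H \<and> act \<pi> x \<noteq> x)"
    by (rule smallE) (simp add: Bex_def act_eq_act' cong: conj_cong)
  have invY: "act \<sigma> x \<epsilon> Y" if \<sigma>: "\<sigma> \<epsilon> H" and x: "x \<epsilon> Y" for \<sigma> x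
  proof -
    obtain \<pi> where \<pi>: "\<pi> \<epsilon> H" "act \<pi> x \<noteq> x" using x Y(2) by blast
    \<comment> \<open>Conjugating a permutation that moves \<open>x\<close> gives one that moves the
      image of \<open>x\<close>.\<close>
    let ?\<rho> = "\<sigma> \<otimes>\<^bsub>Sym\<^esub> \<pi> \<otimes>\<^bsub>Sym\<^esub> inv\<^bsub>Sym\<^esub> \<sigma>"
    have "act ?\<rho> (act \<sigma> x) = act \<sigma> (act \<pi> x)"
      using \<sigma> \<pi>(1) by (simp add: act_mult act_inv_act permutation_mult)
    then have "act ?\<rho> (act \<sigma> x) \<noteq> act \<sigma> x"
      using \<pi>(2) \<sigma> by (simp add: act_inject)
    moreover have "?\<rho> \<epsilon> H" using \<sigma> \<pi>(1) by simp
    ultimately show ?thesis using inv[OF \<sigma>] x Y(2) by blast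
  qed
  have "Y \<in> M"
  proof (rule HSI)
    show "symmetric \<G> \<F> Y"
      by (rule symmetricI[OF H], rule act_fixI) (use Y(1) invY in auto)
    show "y \<in> M" if "y \<epsilon> Y" for y using that Y(2) X(2) by blast
  qed
  have fixed: "act \<pi> x = x" if "x \<in> X" "\<pi> \<epsilon> H" for x \<pi>
  proof (rule ccontr)
    assume "act \<pi> x \<noteq> x"
    then have "x \<epsilon> Y" using that Y(2) by blast
    then obtain m where m: "m \<epsilon> Y" "\<And>y. y \<epsilon> Y \<Longrightarrow> y = m \<or> opair m y \<epsilon> R"
      using least[OF Y(1) \<open>Y \<in> M\<close>] Y(2) by metis
    obtain \<sigma> where \<sigma>: "\<sigma> \<epsilon> H" "act \<sigma> m \<noteq> m" using m(1) Y(2) by blast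
    then have perm: "permutation \<sigma>" by simp
    \<comment> \<open>The least moved point \<open>m\<close> lies below both its image and its
      preimage under \<open>\<sigma>\<close>. Applying \<open>\<sigma>\<close> to the second
      relation puts the image of \<open>m\<close> below \<open>m\<close>, a contradiction.\<close>
    have "opair m (act \<sigma> m) \<epsilon> R"
      using m(2)[OF invY[OF \<sigma>(1) m(1)]] \<sigma>(2) by simp
    moreover have "opair (act \<sigma> m) m \<epsilon> R"
    proof -
      have "act (inv\<^bsub>Sym\<^esub> \<sigma>) m \<noteq> m" using \<sigma>(2) act_act_inv[OF perm, of m] by metis
      then have "opair m (act (inv\<^bsub>Sym\<^esub> \<sigma>) m) \<epsilon> R"
        using m(2)[OF invY[OF filter_inv[OF H \<sigma>(1)] m(1)]] by simp
      then have "act \<sigma> (opair m (act (inv\<^bsub>Sym\<^esub> \<sigma>) m)) \<epsilon> act \<sigma> R"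
        using act_mem_act[OF perm] by simp
      then show ?thesis
        using R[OF \<sigma>(1)] by (simp add: act_opair[OF perm] act_act_inv[OF perm])
    qed
    moreover have "m \<in> X" "act \<sigma> m \<in> X" using m(1) \<sigma>(1) inv Y(2) by blast+
    ultimately show False
      using irrefl trans unfolding irreflp_on_def transp_on_def rel_UNIV by blast
  qed
  have "\<exists>m\<in>elts Z. \<forall>y\<in>elts Z. y = m \<or> rel UNIV R m y"
    if Z: "is_set Z" "elts Z \<subseteq> X" "elts Z \<noteq> {}" for Z
  proof -
    have "Z \<in> M"
    proof (rule HSI)
      show "symmetric \<G> \<F> Z"
        by (rule symmetricI[OF H], rule act_pointwise_fixed) (use Z fixed in auto)
      show "y \<in> M" if "y \<epsilon> Z" for y using that Z(2) X(2) by auto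
    qed
    moreover obtain z where "z \<epsilon> Z" using Z(3) by auto
    ultimately obtain m where "m \<epsilon> Z" "\<forall>y. y \<epsilon> Z \<longrightarrow> y = m \<or> opair m y \<epsilon> R"
      using least[OF Z(1), of z] Z(2) by auto
    then show ?thesis by auto
  qed
  then show ?thesis
    using irrefl trans total unfolding well_ordered_def by blast
qed

text \<open>Only well-foundedness is not immediate, as the universe has more subsets than the model.
  The predecessors of \<open>t\<close> are invariant under any subgroup fixing \<open>t\<close>,
  \<open>T\<close> and \<open>R\<close>, so \<open>well_ordered_UNIV\<close> applies.\<close>

lemma is_tree_UNIV:
  assumes T: "T \<in> M" and R: "R \<in> M" and tree: "is_tree M T R"
  shows "is_tree UNIV T R"
proof -
  note el = elts_HS[OF T]
  have sub: "elts T \<subseteq> M" using HS_mem[OF T] by auto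
  have "well_ordered UNIV {s \<in> elts T. rel UNIV R s t} (rel UNIV R)" if t: "t \<in> elts T" for t
  proof -
    have tM: "t \<in> M" using t sub by auto
    have eq: "{s. s \<epsilon> T \<and> rel M R s t} = {s. s \<epsilon> T \<and> opair s t \<epsilon> R}"
      using rel_HS[OF _ tM] HS_mem[OF T] by auto
    have "well_ordered M {s. s \<epsilon> T \<and> rel M R s t} (rel M R)"
      using tree t by (simp add: is_tree_def el)
    then have wo: "well_ordered M {s. s \<epsilon> T \<and> opair s t \<epsilon> R} (rel M R)"
      unfolding eq .
    \<comment> \<open>Pairing the three objects yields a single subgroup in the filter that fixes
      all of them.\<close>
    have "opair t (opair T R) \<in> M" using tM T R by simp
    then obtain H where H: "H \<epsilon> \<F>" "\<And>\<pi>. \<pi> \<epsilon> H \<Longrightarrow> act \<pi> (opair t (opair T R)) = opair t (opair T R)"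
      using HS_symmetric symmetricE by metis
    have stable: "act \<pi> t = t" "act \<pi> T = T" "act \<pi> R = R" and perm: "permutation \<pi>" if "\<pi> \<epsilon> H" for \<pi>
      using H(2)[OF that] filter_mem_\<G>[OF H(1) that] by (simp_all add: act_opair)
    have "well_ordered UNIV {s. s \<epsilon> T \<and> opair s t \<epsilon> R} (rel UNIV R)"
    proof (rule well_ordered_UNIV[OF H(1) _ _ _ _ wo])
      show "small {s. s \<epsilon> T \<and> opair s t \<epsilon> R}"
        by (rule small_separation) (intro definable_intros)
      show "{s. s \<epsilon> T \<and> opair s t \<epsilon> R} \<subseteq> M" using HS_mem[OF T] by auto
      show "act \<pi> R = R" if "\<pi> \<epsilon> H" for \<pi> by (rule stable(3)[OF that])
      show "act \<pi> s \<in> {s. s \<epsilon> T \<and> opair s t \<epsilon> R}"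
        if "\<pi> \<epsilon> H" "s \<in> {s. s \<epsilon> T \<and> opair s t \<epsilon> R}" for \<pi> s
        using that(2) act_mem_act[OF perm[OF that(1)], of s T]
          act_mem_act[OF perm[OF that(1)], of "opair s t" R] stable[OF that(1)]
        by (simp add: act_opair[OF perm[OF that(1)]])
    qed
    then show ?thesis by simp
  qed
  then show ?thesis
    using tree rel_HS_on[OF sub] by (simp add: is_tree_def el)
qed

end


section \<open>Ordinals in the permutation model\<close>

lemma osucc: "is_set (osucc \<alpha>)" "u \<epsilon> osucc \<alpha> \<longleftrightarrow> u = \<alpha> \<or> u \<epsilon> \<alpha>"
proof -
  obtain s where s: "is_set s" "elts s = insert \<alpha> (elts \<alpha>)"
    using small_insert[OF small_elts, of \<alpha> \<alpha>] by (auto simp: small_def)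
  have "is_set (osucc \<alpha>) \<and> elts (osucc \<alpha>) = insert \<alpha> (elts \<alpha>)"
    unfolding osucc_def
  proof (rule theI[of _ s])
    show "t = s" if "is_set t \<and> elts t = insert \<alpha> (elts \<alpha>)" for t
      by (rule extensionality) (use s that in blast)+
  qed (use s in simp)
  then show "is_set (osucc \<alpha>)" "u \<epsilon> osucc \<alpha> \<longleftrightarrow> u = \<alpha> \<or> u \<epsilon> \<alpha>"
    by (metis, metis insert_iff mem_elts_iff)
qed

lemma ordinalD:
  assumes "ordinal \<kappa>"
  shows ordinal_transitive: "transitive_set \<kappa>"
    and ordinal_mem_is_set: "\<beta> \<epsilon> \<kappa> \<Longrightarrow> is_set \<beta>"
    and ordinal_irrefl: "\<beta> \<epsilon> \<kappa> \<Longrightarrow> \<not> \<beta> \<epsilon> \<beta>"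
    and ordinal_trans: "\<gamma> \<epsilon> \<kappa> \<Longrightarrow> \<alpha> \<epsilon> \<beta> \<Longrightarrow> \<beta> \<epsilon> \<gamma> \<Longrightarrow> \<alpha> \<epsilon> \<gamma>"
    and ordinal_total: "\<alpha> \<epsilon> \<kappa> \<Longrightarrow> \<beta> \<epsilon> \<kappa> \<Longrightarrow> \<alpha> \<epsilon> \<beta> \<or> \<alpha> = \<beta> \<or> \<beta> \<epsilon> \<alpha>"
proof -
  show t: "transitive_set \<kappa>" using assms by (simp add: ordinal_def transitive_set_def)
  show "\<beta> \<epsilon> \<kappa> \<Longrightarrow> is_set \<beta>" using assms by (simp add: ordinal_def)
  have wo: "irreflp_on (elts \<kappa>) mem" "transp_on (elts \<kappa>) mem" "totalp_on (elts \<kappa>) mem"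
    using assms by (simp_all add: ordinal_def well_ordered_def)
  show "\<beta> \<epsilon> \<kappa> \<Longrightarrow> \<not> \<beta> \<epsilon> \<beta>" using wo(1) by (simp add: irreflp_on_def)
  show "\<alpha> \<epsilon> \<gamma>" if "\<gamma> \<epsilon> \<kappa>" "\<alpha> \<epsilon> \<beta>" "\<beta> \<epsilon> \<gamma>"
  proof -
    have "\<beta> \<epsilon> \<kappa>" using transitive_setD[OF t that(3,1)] .
    moreover from this have "\<alpha> \<epsilon> \<kappa>" using transitive_setD[OF t that(2)] by simp
    ultimately show ?thesis
      using wo(2) that unfolding transp_on_def by (meson mem_elts_iff)
  qed
  show "\<alpha> \<epsilon> \<kappa> \<Longrightarrow> \<beta> \<epsilon> \<kappa> \<Longrightarrow> \<alpha> \<epsilon> \<beta> \<or> \<alpha> = \<beta> \<or> \<beta> \<epsilon> \<alpha>"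
    using wo(3) unfolding totalp_on_def by (meson mem_elts_iff)
qed

text \<open>If some element of \<open>\<kappa>\<close> lies outside \<open>osucc \<alpha>\<close>,
  the least such element equals \<open>osucc \<alpha>\<close>; otherwise
  \<open>osucc \<alpha>\<close> is \<open>\<kappa>\<close> itself.\<close>

lemma osucc_mem_osucc:
  assumes \<kappa>: "ordinal \<kappa>" and \<alpha>: "\<alpha> \<epsilon> \<kappa>"
  shows "osucc \<alpha> \<epsilon> osucc \<kappa>"
proof -
  note t = transitive_setD[OF ordinal_transitive[OF \<kappa>]]
  have sub: "u \<epsilon> \<kappa>" if "u \<epsilon> osucc \<alpha>" for u
    using that \<alpha> t by (auto simp: osucc)
  show ?thesis
  proof (cases "\<exists>u. u \<epsilon> \<kappa> \<and> \<not> u \<epsilon> osucc \<alpha>")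
    case True
    then obtain u where u: "u \<epsilon> \<kappa>" "\<not> u \<epsilon> osucc \<alpha>" by blast
    have "definable (\<lambda>e. \<not> e 0 \<epsilon> osucc \<alpha>)" by (intro definable_intros)
    then obtain m where m: "m \<epsilon> \<kappa>" "\<not> m \<epsilon> osucc \<alpha>"
      "\<And>z. z \<epsilon> m \<Longrightarrow> z \<epsilon> \<kappa> \<Longrightarrow> \<not> \<not> z \<epsilon> osucc \<alpha>"
      using mem_minimal[of "\<lambda>x. \<not> x \<epsilon> osucc \<alpha>", OF _ u] by metis
    have "\<alpha> \<epsilon> m" using ordinal_total[OF \<kappa> \<alpha> m(1)] m(2) by (auto simp: osucc)
    have "osucc \<alpha> = m"
    proof (rule is_set_eqI)
      show "is_set (osucc \<alpha>)" by (rule osucc)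
      show "is_set m" by (rule ordinal_mem_is_set[OF \<kappa> m(1)])
      show "u \<epsilon> osucc \<alpha> \<longleftrightarrow> u \<epsilon> m" for u
        using m(3) t[OF _ m(1)] \<open>\<alpha> \<epsilon> m\<close> ordinal_trans[OF \<kappa> m(1) _ \<open>\<alpha> \<epsilon> m\<close>]
        unfolding osucc by blast
    qed
    then show ?thesis using m(1) by (simp add: osucc)
  next
    case False
    then have "osucc \<alpha> = \<kappa>"
      using sub \<kappa> by (intro is_set_eqI) (auto simp: osucc ordinal_def)
    then show ?thesis by (simp add: osucc)
  qed
qed

text \<open>No atoms occur in the build-up of an ordinal, so induction along membership fixes each
  element.\<close>

lemma act_ordinal:
  assumes \<kappa>: "ordinal \<kappa>" and \<pi>: "permutation \<pi>"
  shows "\<beta> \<epsilon> \<kappa> \<Longrightarrow> act \<pi> \<beta> = \<beta>" "act \<pi> \<kappa> = \<kappa>"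
proof -
  show stable: "act \<pi> \<beta> = \<beta>" if "\<beta> \<epsilon> \<kappa>" for \<beta>
  proof (rule transitive_set_induct[of \<kappa> "\<lambda>x. act \<pi> x = x", OF _ _ that])
    show "transitive_set \<kappa>" by (rule ordinal_transitive[OF \<kappa>])
    show "definable (\<lambda>e. act \<pi> (e 0) = e 0)"
      unfolding act_eq_act'[OF \<pi>] by (intro definable_intros)
    show "act \<pi> x = x" if "x \<epsilon> \<kappa>" "\<And>y. y \<epsilon> x \<Longrightarrow> act \<pi> y = y" for x
      by (rule act_pointwise_fixed[OF \<pi>]) (use that ordinal_mem_is_set[OF \<kappa>] in auto)
  qed
  show "act \<pi> \<kappa> = \<kappa>"
    by (rule act_pointwise_fixed[OF \<pi>]) (use stable \<kappa> in \<open>auto simp: ordinal_def\<close>)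
qed

text \<open>Index zero supplies the reference permutation in \<open>chain_HS\<close>. Since the
  empty ordinal is a natural number, an infinite cardinal is nonempty.\<close>

lemma exists_zero:
  assumes \<kappa>: "infinite_cardinal \<kappa>"
  obtains z where "z \<epsilon> \<kappa>" "\<And>\<beta>. \<beta> \<epsilon> \<kappa> \<Longrightarrow> \<beta> = z \<or> z \<epsilon> \<beta>"
proof -
  have ord: "ordinal \<kappa>" and "\<not> natural_number \<kappa>"
    using \<kappa> by (simp_all add: infinite_cardinal_def)
  then have "elts \<kappa> \<noteq> {}" by (auto simp: natural_number_def)
  from foundation[OF this] obtain z where z: "z \<epsilon> \<kappa>" "elts z \<inter> elts \<kappa> = {}" by auto
  then have "\<beta> = z \<or> z \<epsilon> \<beta>" if "\<beta> \<epsilon> \<kappa>" for \<beta>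
    using ordinal_total[OF ord that z(1)] that by auto
  then show ?thesis using that z(1) by blast
qed

context permutation_model
begin

lemma ordinal_HS:
  assumes "ordinal \<kappa>" shows "\<kappa> \<in> M"
proof -
  obtain H where H: "H \<epsilon> \<F>" by (rule filter_nonempty)
  have "symmetric \<G> \<F> x" if "x = \<kappa> \<or> x \<epsilon> \<kappa>" for x
    by (rule symmetricI[OF H])
      (use that act_ordinal[OF assms] filter_mem_\<G>[OF H] in auto)
  moreover have "transitive_closure \<kappa> \<subseteq> elts \<kappa>"
    using ordinal_transitive[OF assms] by (auto simp: transitive_closure_def)
  ultimately show ?thesis by (auto simp: HS_def)
qed


section \<open>Transfer of dependent choice\<close>

text \<open>Shift completeness read through stabilizers: it is applied to the subgroups
  \<open>stab (x \<beta>)\<close>, and its second condition says that later permutations treat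
  \<open>x \<alpha>\<close> as the one at \<open>\<alpha>\<close> does. Definability of
  \<open>x\<close> makes the sequence of stabilizers a function of the universe.\<close>

lemma shift:
  assumes complete: "shift_complete \<G> \<F> \<delta>" "\<gamma> \<epsilon> \<delta>"
    and x: "definable_term (\<lambda>e. x (e 0))" "\<And>\<beta>. \<beta> \<epsilon> \<gamma> \<Longrightarrow> symmetric \<G> \<F> (x \<beta>)"
  obtains L \<sigma> where "L \<epsilon> \<F>" "\<And>\<beta>. \<beta> \<epsilon> \<gamma> \<Longrightarrow> appl \<sigma> \<beta> \<epsilon> \<G>"
    "\<And>\<pi> \<beta>. \<pi> \<epsilon> L \<Longrightarrow> \<beta> \<epsilon> \<gamma> \<Longrightarrow> act \<pi> (act (appl \<sigma> \<beta>) (x \<beta>)) = act (appl \<sigma> \<beta>) (x \<beta>)"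
    "\<And>\<alpha> \<beta>. \<alpha> \<epsilon> \<gamma> \<Longrightarrow> \<beta> \<epsilon> \<gamma> \<Longrightarrow> \<alpha> \<epsilon> \<beta> \<Longrightarrow> act (appl \<sigma> \<beta>) (x \<alpha>) = act (appl \<sigma> \<alpha>) (x \<alpha>)"
proof -
  have dt: "definable_term (\<lambda>e. stab (x (e 0)))"
    by (intro definable_term_stab x(1))
  let ?H = "lam \<gamma> (\<lambda>\<beta>. stab (x \<beta>))"
  have H: "is_function UNIV ?H (elts \<gamma>) (elts \<F>)"
    by (rule is_function_lam[OF dt]) (use x(2) symmetric_iff in auto)
  have app_H: "app UNIV ?H \<beta> = stab (x \<beta>)" if "\<beta> \<epsilon> \<gamma>" for \<beta>
    using app_eq_appl[OF H, of \<beta>] appl_lam[OF dt that] that by simp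
  let ?K = "\<lambda>\<sigma> \<alpha>. conjugate (app UNIV \<sigma> \<alpha>) (elts (app UNIV ?H \<alpha>))"
  have "\<gamma> \<in> elts \<delta>" using complete(2) by simp
  then obtain \<sigma> L where \<sigma>: "is_function UNIV \<sigma> (elts \<gamma>) (elts \<G>)" and L: "L \<in> elts \<F>"
    "elts L = {\<pi> \<in> elts \<G>. \<forall>\<alpha>\<in>elts \<gamma>. \<pi> \<in> ?K \<sigma> \<alpha>}"
    and shift: "\<forall>\<alpha>\<in>elts \<gamma>. \<forall>\<beta>\<in>elts \<gamma>. \<alpha> \<epsilon> \<beta> \<longrightarrow>
      app UNIV \<sigma> \<beta> \<otimes>\<^bsub>Sym\<^esub> inv\<^bsub>Sym\<^esub> (app UNIV \<sigma> \<alpha>) \<in> ?K \<sigma> \<alpha>"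
    using complete(1) H unfolding shift_complete_def Let_def by meson
  have \<sigma>\<G>: "appl \<sigma> \<beta> \<epsilon> \<G>" if "\<beta> \<epsilon> \<gamma>" for \<beta>
    using appl_mem[OF \<sigma>, of \<beta>] that by simp
  have K: "act \<pi> (act (appl \<sigma> \<beta>) (x \<beta>)) = act (appl \<sigma> \<beta>) (x \<beta>)" if "\<pi> \<in> ?K \<sigma> \<beta>" "\<beta> \<epsilon> \<gamma>" for \<pi> \<beta>
    using mem_conjugate_stab[OF \<sigma>\<G>[OF that(2)], of \<pi> "x \<beta>"] that app_H app_eq_appl[OF \<sigma>, of \<beta>]
    by simp
  show ?thesis
  proof (rule that[of L \<sigma>])
    show "L \<epsilon> \<F>" using L(1) by simp
    show "act \<pi> (act (appl \<sigma> \<beta>) (x \<beta>)) = act (appl \<sigma> \<beta>) (x \<beta>)" if "\<pi> \<epsilon> L" "\<beta> \<epsilon> \<gamma>" for \<pi> \<beta>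
    proof -
      have "\<pi> \<in> elts L" using that(1) by simp
      then show ?thesis using K[OF _ that(2)] that(2) unfolding L(2) by simp
    qed
    show "act (appl \<sigma> \<beta>) (x \<alpha>) = act (appl \<sigma> \<alpha>) (x \<alpha>)" if "\<alpha> \<epsilon> \<gamma>" "\<beta> \<epsilon> \<gamma>" "\<alpha> \<epsilon> \<beta>" for \<alpha> \<beta>
    proof -
      have "appl \<sigma> \<beta> \<otimes>\<^bsub>Sym\<^esub> inv\<^bsub>Sym\<^esub> (appl \<sigma> \<alpha>) \<in> ?K \<sigma> \<alpha>"
        using shift that app_eq_appl[OF \<sigma>] by simp
      from K[OF this that(1)] show ?thesis
        using \<sigma>\<G> that by (simp add: act_mult permutation_inv act_inv_act)
    qed
  qed (rule \<sigma>\<G>)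
qed

text \<open>Shift completeness one step beyond \<open>\<alpha>\<close> makes the filter closed under intersections of
  length \<open>\<alpha>\<close>: all \<open>\<sigma>\<^sub>\<beta>\<close> with \<open>\<beta> < \<alpha>\<close> may be replaced by the last one, \<open>\<sigma>\<^sub>\<alpha>\<close>, so \<open>\<sigma>\<^sub>\<alpha>\<close>
  conjugates the intersection of the original subgroups into the filter.\<close>

lemma filter_fixes_sequence:
  assumes complete: "shift_complete \<G> \<F> \<delta>" "osucc \<alpha> \<epsilon> \<delta>" and \<alpha>: "\<alpha> \<in> M" "\<not> \<alpha> \<epsilon> \<alpha>"
    and x: "definable_term (\<lambda>e. x (e 0))" "\<And>\<beta>. \<beta> \<epsilon> \<alpha> \<Longrightarrow> x \<beta> \<in> M"
  obtains L where "L \<epsilon> \<F>" "\<And>\<pi> \<beta>. \<pi> \<epsilon> L \<Longrightarrow> \<beta> \<epsilon> \<alpha> \<Longrightarrow> act \<pi> (x \<beta>) = x \<beta>"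
proof -
  \<comment> \<open>The sequence gets one more term, at index \<open>\<alpha>\<close>, so that a
    last permutation exists. The value there only has to be symmetric; \<open>\<alpha>\<close>
    itself serves.\<close>
  let ?x = "\<lambda>\<beta>. if \<beta> \<epsilon> \<alpha> then x \<beta> else \<alpha>"
  have dt: "definable_term (\<lambda>e. ?x (e 0))" by (intro definable_intros x(1))
  have sym: "symmetric \<G> \<F> (?x \<beta>)" for \<beta>
    using x(2) \<alpha>(1) HS_symmetric by simp
  obtain L \<sigma> where L: "L \<epsilon> \<F>" and \<sigma>: "\<And>\<beta>. \<beta> \<epsilon> osucc \<alpha> \<Longrightarrow> appl \<sigma> \<beta> \<epsilon> \<G>"
    and stable: "\<And>\<pi> \<beta>. \<pi> \<epsilon> L \<Longrightarrow> \<beta> \<epsilon> osucc \<alpha> \<Longrightarrow> act \<pi> (act (appl \<sigma> \<beta>) (?x \<beta>)) = act (appl \<sigma> \<beta>) (?x \<beta>)"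
    and shift: "\<And>\<gamma> \<beta>. \<gamma> \<epsilon> osucc \<alpha> \<Longrightarrow> \<beta> \<epsilon> osucc \<alpha> \<Longrightarrow> \<gamma> \<epsilon> \<beta> \<Longrightarrow>
      act (appl \<sigma> \<beta>) (?x \<gamma>) = act (appl \<sigma> \<gamma>) (?x \<gamma>)"
    using shift[OF complete dt sym] by metis
  let ?\<tau> = "appl \<sigma> \<alpha>"
  have \<tau>: "?\<tau> \<epsilon> \<G>" using \<sigma> by (simp add: osucc)
  \<comment> \<open>By the shift condition the last permutation acts on each
    \<open>x \<beta>\<close> as the one at \<open>\<beta>\<close> does, so a single
    \<open>?\<tau>\<close> moves the whole sequence to objects fixed by \<open>L\<close>.
    Conjugating \<open>L\<close> by its inverse undoes this move.\<close>
  have fix_\<tau>: "act \<pi> (act ?\<tau> (x \<beta>)) = act ?\<tau> (x \<beta>)" if "\<pi> \<epsilon> L" "\<beta> \<epsilon> \<alpha>" for \<pi> \<beta>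
    using stable[OF that(1), of \<beta>] shift[of \<beta> \<alpha>] that(2) by (simp add: osucc)
  obtain L' where L': "L' \<epsilon> \<F>" "\<And>\<pi> y. \<pi> \<epsilon> L' \<Longrightarrow> (\<And>h. h \<epsilon> L \<Longrightarrow> act h y = y) \<Longrightarrow>
      act \<pi> (act (inv\<^bsub>Sym\<^esub> ?\<tau>) y) = act (inv\<^bsub>Sym\<^esub> ?\<tau>) y"
    using filter_conjugate[OF L inv_\<G>[OF \<tau>]] by blast
  show ?thesis
    by (rule that[OF L'(1)])
      (use L'(2)[OF _ fix_\<tau>] \<tau> in \<open>simp add: act_inv_act\<close>)
qed

text \<open>Ordinals are fixed by all permutations of the group, so a subgroup fixing every value
  fixes every pair in \<open>f\<close>, hence also \<open>f\<close> and its range.\<close>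

lemma function_HS:
  assumes f: "is_function UNIV f (elts \<alpha>) Y" and \<alpha>: "ordinal \<kappa>" "\<alpha> = \<kappa> \<or> \<alpha> \<epsilon> \<kappa>"
    and L: "L \<epsilon> \<F>" and stable: "\<And>\<pi> \<beta>. \<pi> \<epsilon> L \<Longrightarrow> \<beta> \<epsilon> \<alpha> \<Longrightarrow> act \<pi> (appl f \<beta>) = appl f \<beta>"
    and M: "\<And>\<beta>. \<beta> \<epsilon> \<alpha> \<Longrightarrow> appl f \<beta> \<in> M"
  shows "f \<in> M" "is_set C \<Longrightarrow> elts C = appl f ` elts \<alpha> \<Longrightarrow> C \<in> M"
proof -
  note mem_f = mem_function[OF f]
  have sub: "\<beta> \<epsilon> \<kappa>" if "\<beta> \<epsilon> \<alpha>" for \<beta>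
    using that \<alpha> transitive_setD[OF ordinal_transitive[OF \<alpha>(1)]] by blast
  have perm: "permutation \<pi>" if "\<pi> \<epsilon> L" for \<pi>
    using filter_mem_\<G>[OF L that] by simp
  show "f \<in> M"
  proof (rule HSI)
    show "symmetric \<G> \<F> f"
      by (rule symmetricI[OF L], rule act_pointwise_fixed)
        (use f perm stable sub act_ordinal[OF \<alpha>(1)] in
          \<open>auto simp: mem_f is_function_def act_opair\<close>)
    show "p \<in> M" if "p \<epsilon> f" for p
      using that M sub HS_mem[OF ordinal_HS[OF \<alpha>(1)]] by (auto simp: mem_f)
  qed
  assume C: "is_set C" "elts C = appl f ` elts \<alpha>"
  then have mem_C: "c \<epsilon> C \<longleftrightarrow> (\<exists>\<beta>. \<beta> \<epsilon> \<alpha> \<and> c = appl f \<beta>)" for c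
    by (metis (no_types, lifting) image_iff mem_elts_iff)
  show "C \<in> M"
  proof (rule HSI)
    show "symmetric \<G> \<F> C"
      by (rule symmetricI[OF L], rule act_pointwise_fixed) (use C(1) perm stable in \<open>auto simp: mem_C\<close>)
    show "c \<in> M" if "c \<epsilon> C" for c
      using that M by (auto simp: mem_C)
  qed
qed

lemma has_order_type_HS:
  assumes M: "f \<in> M" "C \<in> M" "\<alpha> \<in> M"
    and bij: "is_bijection UNIV f (elts \<alpha>) (elts C)"
    and iso: "\<forall>\<beta>\<in>elts \<alpha>. \<forall>\<gamma>\<in>elts \<alpha>. \<beta> \<epsilon> \<gamma> \<longleftrightarrow> opair (appl f \<beta>) (appl f \<gamma>) \<epsilon> R"
  shows "has_order_type M R C \<alpha>"
proof -
  have sub: "elts \<alpha> \<subseteq> M" "elts C \<subseteq> M" using M HS_mem by auto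
  note b = is_bijection_HS[OF M(1) sub bij]
  have "appl f \<beta> \<in> M" if "\<beta> \<epsilon> \<alpha>" for \<beta>
    using appl_mem[of f "elts \<alpha>" "elts C" \<beta>] bij sub that by (auto simp: is_bijection_def)
  then have "rel M R (app M f \<beta>) (app M f \<gamma>) \<longleftrightarrow> opair (appl f \<beta>) (appl f \<gamma>) \<epsilon> R"
    if "\<beta> \<in> elts \<alpha>" "\<gamma> \<in> elts \<alpha>" for \<beta> \<gamma>
    using that b(2) by (simp add: rel_HS)
  then show ?thesis
    unfolding has_order_type_def elts_HS[OF M(2)] elts_HS[OF M(3)]
    using M(1) b(1) iso by (intro bexI[of _ f] conjI ballI) blast+
qed

lemma is_chain_HS:
  assumes "T \<in> M" "C \<in> M"
  shows "is_chain M T R C \<longleftrightarrow> is_chain UNIV T R C"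
proof -
  have "elts C \<subseteq> M" using HS_mem[OF assms(2)] by auto
  then show ?thesis
    using rel_HS_on(3)[of "elts C" R] by (simp add: is_chain_def elts_HS assms)
qed

lemma order_type_UNIV:
  assumes "has_order_type UNIV R C \<alpha>"
  obtains f where "is_bijection UNIV f (elts \<alpha>) (elts C)" "elts C = appl f ` elts \<alpha>"
    "\<forall>\<beta>\<in>elts \<alpha>. \<forall>\<gamma>\<in>elts \<alpha>. \<beta> \<epsilon> \<gamma> \<longleftrightarrow> opair (appl f \<beta>) (appl f \<gamma>) \<epsilon> R"
proof -
  obtain f where f: "is_bijection UNIV f (elts \<alpha>) (elts C)"
    "\<forall>\<beta>\<in>elts \<alpha>. \<forall>\<gamma>\<in>elts \<alpha>. \<beta> \<epsilon> \<gamma> \<longleftrightarrow> opair (app UNIV f \<beta>) (app UNIV f \<gamma>) \<epsilon> R"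
    using assms unfolding has_order_type_def rel_UNIV by blast
  have app: "app UNIV f \<beta> = appl f \<beta>" if "\<beta> \<in> elts \<alpha>" for \<beta>
    using f(1) app_eq_appl that by (auto simp: is_bijection_def)
  have "app UNIV f ` elts \<alpha> = elts C"
    using f(1) by (simp add: is_bijection_def bij_betw_def)
  then have "elts C = appl f ` elts \<alpha>"
    using image_cong[OF refl app, of "elts \<alpha>"] by simp
  moreover have "\<forall>\<beta>\<in>elts \<alpha>. \<forall>\<gamma>\<in>elts \<alpha>. \<beta> \<epsilon> \<gamma> \<longleftrightarrow> opair (appl f \<beta>) (appl f \<gamma>) \<epsilon> R"
    using f(2) app by (metis (no_types, lifting))
  ultimately show ?thesis by (rule that[OF f(1)])
qed

text \<open>For \<open>\<alpha>\<close> in \<open>\<kappa>\<close> the length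
  \<open>osucc \<alpha>\<close> is still allowed, so one subgroup in the filter fixes the whole
  chain pointwise. Chain and enumeration thus belong to the model, and closure there provides the
  upper bound.\<close>

lemma closed_tree_UNIV:
  assumes complete: "shift_complete \<G> \<F> (osucc \<kappa>)" and \<kappa>: "ordinal \<kappa>"
    and T: "T \<in> M" and closed: "closed_tree M \<kappa> T R"
  shows "closed_tree UNIV \<kappa> T R"
  unfolding closed_tree_def
proof (intro ballI impI, elim conjE bexE)
  fix C \<alpha>
  assume C: "is_chain UNIV T R C" and "\<alpha> \<in> elts \<kappa>" and ot: "has_order_type UNIV R C \<alpha>"
  then have \<alpha>: "\<alpha> \<epsilon> \<kappa>" by simp
  obtain f where f: "is_bijection UNIV f (elts \<alpha>) (elts C)" "elts C = appl f ` elts \<alpha>"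
    "\<forall>\<beta>\<in>elts \<alpha>. \<forall>\<gamma>\<in>elts \<alpha>. \<beta> \<epsilon> \<gamma> \<longleftrightarrow> opair (appl f \<beta>) (appl f \<gamma>) \<epsilon> R"
    by (rule order_type_UNIV[OF ot])
  have fn: "is_function UNIV f (elts \<alpha>) (elts C)" using f(1) by (simp add: is_bijection_def)
  have fM: "appl f \<beta> \<in> M" if "\<beta> \<epsilon> \<alpha>" for \<beta>
    using appl_mem[OF fn, of \<beta>] C that HS_mem[OF T] by (auto simp: is_chain_def)
  have \<kappa>M: "\<kappa> \<in> M" by (rule ordinal_HS[OF \<kappa>])
  have \<alpha>M: "\<alpha> \<in> M" by (rule HS_mem[OF \<kappa>M \<alpha>])
  have dt: "definable_term (\<lambda>e. appl f (e 0))" by (intro definable_intros)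
  obtain L where L: "L \<epsilon> \<F>" "\<And>\<pi> \<beta>. \<pi> \<epsilon> L \<Longrightarrow> \<beta> \<epsilon> \<alpha> \<Longrightarrow> act \<pi> (appl f \<beta>) = appl f \<beta>"
    using filter_fixes_sequence[OF complete osucc_mem_osucc[OF \<kappa> \<alpha>] \<alpha>M ordinal_irrefl[OF \<kappa> \<alpha>] dt fM]
    by blast
  have M: "f \<in> M" "C \<in> M"
    using function_HS[OF fn \<kappa> _ L fM] \<alpha> f(2) C by (simp_all add: is_chain_def)
  have "is_chain M T R C" using is_chain_HS[OF T M(2)] C by simp
  moreover have "has_order_type M R C \<alpha>" by (rule has_order_type_HS[OF M \<alpha>M f(1,3)])
  ultimately obtain t where "t \<epsilon> T" "\<forall>c\<in>elts C. c = t \<or> rel M R c t"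
    using closed M(2) \<alpha> unfolding closed_tree_def elts_HS[OF T] elts_HS[OF \<kappa>M]
    by (metis elts_HS mem_elts_iff)
  moreover have "rel M R c t \<longleftrightarrow> rel UNIV R c t" if "c \<in> elts C" "t \<epsilon> T" for c t
    using that HS_mem[OF M(2)] HS_mem[OF T] rel_HS by simp
  ultimately show "\<exists>t\<in>elts T. \<forall>c\<in>elts C. c = t \<or> rel UNIV R c t"
    by (intro bexI[of _ t]) auto
qed

text \<open>The composite of the permutation at \<open>\<beta>\<close> with the inverse of the one
  at zero fixes the tree and sends every chain element up to index \<open>\<beta>\<close> to its
  counterpart in the new sequence. The order is therefore preserved although the permutations
  vary.\<close>

lemma chain_HS:
  assumes complete: "shift_complete \<G> \<F> (osucc \<kappa>)" and \<kappa>: "infinite_cardinal \<kappa>"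
    and T: "T \<in> M" and R: "R \<in> M" and tree: "is_tree UNIV T R"
    and C: "is_chain UNIV T R C" and ot: "has_order_type UNIV R C \<kappa>"
  obtains D where "D \<in> M" "is_chain M T R D" "has_order_type M R D \<kappa>"
proof -
  have ord: "ordinal \<kappa>" using \<kappa> by (simp add: infinite_cardinal_def)
  obtain f where f: "is_bijection UNIV f (elts \<kappa>) (elts C)" "elts C = appl f ` elts \<kappa>"
    "\<forall>\<beta>\<in>elts \<kappa>. \<forall>\<gamma>\<in>elts \<kappa>. \<beta> \<epsilon> \<gamma> \<longleftrightarrow> opair (appl f \<beta>) (appl f \<gamma>) \<epsilon> R"
    by (rule order_type_UNIV[OF ot])
  have fn: "is_function UNIV f (elts \<kappa>) (elts C)" using f(1) by (simp add: is_bijection_def)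
  have fT: "appl f \<beta> \<epsilon> T" if "\<beta> \<epsilon> \<kappa>" for \<beta>
    using appl_mem[OF fn, of \<beta>] C that by (auto simp: is_chain_def)
  \<comment> \<open>Including \<open>T\<close> and \<open>R\<close> in each term makes the shift
    condition apply to the tree as well.\<close>
  let ?x = "\<lambda>\<beta>. opair (appl f \<beta>) (opair T R)"
  have dt: "definable_term (\<lambda>e. ?x (e 0))" by (intro definable_intros)
  have sym: "symmetric \<G> \<F> (?x \<beta>)" if "\<beta> \<epsilon> \<kappa>" for \<beta>
    by (rule HS_symmetric) (use T R HS_mem[OF T fT[OF that]] in simp)
  have "\<kappa> \<epsilon> osucc \<kappa>" by (simp add: osucc)
  then obtain \<sigma> L where L: "L \<epsilon> \<F>" and \<sigma>: "\<And>\<beta>. \<beta> \<epsilon> \<kappa> \<Longrightarrow> appl \<sigma> \<beta> \<epsilon> \<G>"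
    and stable: "\<And>\<pi> \<beta>. \<pi> \<epsilon> L \<Longrightarrow> \<beta> \<epsilon> \<kappa> \<Longrightarrow> act \<pi> (act (appl \<sigma> \<beta>) (?x \<beta>)) = act (appl \<sigma> \<beta>) (?x \<beta>)"
    and shift: "\<And>\<alpha> \<beta>. \<alpha> \<epsilon> \<kappa> \<Longrightarrow> \<beta> \<epsilon> \<kappa> \<Longrightarrow> \<alpha> \<epsilon> \<beta> \<Longrightarrow> act (appl \<sigma> \<beta>) (?x \<alpha>) = act (appl \<sigma> \<alpha>) (?x \<alpha>)"
    using shift[OF complete _ dt sym] by metis
  note [simp] = act_opair[OF permutation_\<G>[OF \<sigma>]] act_opair[OF permutation_\<G>[OF filter_mem_\<G>[OF L]]]
  have shift_f: "act (appl \<sigma> \<beta>) (appl f \<alpha>) = act (appl \<sigma> \<alpha>) (appl f \<alpha>)"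
    and shift_TR: "act (appl \<sigma> \<beta>) T = act (appl \<sigma> \<alpha>) T" "act (appl \<sigma> \<beta>) R = act (appl \<sigma> \<alpha>) R"
    if "\<alpha> \<epsilon> \<kappa>" "\<beta> \<epsilon> \<kappa>" "\<alpha> \<epsilon> \<beta>" for \<alpha> \<beta>
    using shift[OF that] that by simp_all
  obtain z where z: "z \<epsilon> \<kappa>" "\<And>\<beta>. \<beta> \<epsilon> \<kappa> \<Longrightarrow> \<beta> = z \<or> z \<epsilon> \<beta>"
    using exists_zero[OF \<kappa>] by blast
  define \<tau> where "\<tau> = inv\<^bsub>Sym\<^esub> (appl \<sigma> z)"
  have \<tau>: "\<tau> \<epsilon> \<G>" using \<sigma>[OF z(1)] by (simp add: \<tau>_def)
  have \<tau>_inv: "act \<tau> (act (appl \<sigma> z) u) = u" for u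
    using \<sigma>[OF z(1)] by (simp add: \<tau>_def act_inv_act)
  \<comment> \<open>Written with \<open>act'\<close> instead of \<open>act\<close>, the new sequence
    is a definable term, so it yields a function of the universe.\<close>
  define y where "y \<beta> = act' \<tau> (act' (appl \<sigma> \<beta>) (appl f \<beta>))" for \<beta>
  have y_definable: "definable_term (\<lambda>e. y (e 0))"
    unfolding y_def by (intro definable_intros)
  have y: "y \<beta> = act \<tau> (act (appl \<sigma> \<beta>) (appl f \<beta>))" if "\<beta> \<epsilon> \<kappa>" for \<beta>
    using \<sigma>[OF that] \<tau> by (simp add: y_def act_eq_act')
  \<comment> \<open>All permutations of the sequence move the tree in the same way as the one at
    zero, and \<open>\<tau>\<close> undoes that.\<close>
  have fixed: "act \<tau> (act (appl \<sigma> \<beta>) T) = T" "act \<tau> (act (appl \<sigma> \<beta>) R) = R" if "\<beta> \<epsilon> \<kappa>" for \<beta>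
    using z(2)[OF that] shift_TR[OF z(1) that] \<tau>_inv by auto
  have yT: "y \<beta> \<epsilon> T" if "\<beta> \<epsilon> \<kappa>" for \<beta>
  proof -
    have "act \<tau> (act (appl \<sigma> \<beta>) (appl f \<beta>)) \<epsilon> act \<tau> (act (appl \<sigma> \<beta>) T)"
      using fT[OF that] \<sigma>[OF that] \<tau> by (simp add: act_mem_act)
    then show ?thesis using fixed that y by simp
  qed
  have y_less: "opair (y \<alpha>) (y \<beta>) \<epsilon> R" if "\<alpha> \<epsilon> \<kappa>" "\<beta> \<epsilon> \<kappa>" "\<alpha> \<epsilon> \<beta>" for \<alpha> \<beta>
  proof -
    have "opair (appl f \<alpha>) (appl f \<beta>) \<epsilon> R" using f(3) that by auto
    \<comment> \<open>Both coordinates are moved by the permutation of the larger index;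
      \<open>shift_f\<close> replaces it by the one at \<open>\<alpha>\<close> in the first
      coordinate.\<close>
    then have "act \<tau> (act (appl \<sigma> \<beta>) (opair (appl f \<alpha>) (appl f \<beta>))) \<epsilon> act \<tau> (act (appl \<sigma> \<beta>) R)"
      by (simp only: act_mem_act[OF permutation_\<G>[OF \<sigma>[OF that(2)]]] act_mem_act[OF permutation_\<G>[OF \<tau>]])
    then show ?thesis
      using fixed that y \<tau> \<sigma>[OF that(2)] shift_f[OF that] by (simp add: act_opair)
  qed
  have irrefl: "\<not> opair u u \<epsilon> R" if "u \<epsilon> T" for u
    using tree that by (simp add: is_tree_def irreflp_on_def)
  have trans: "opair u w \<epsilon> R" if "u \<epsilon> T" "v \<epsilon> T" "w \<epsilon> T" "opair u v \<epsilon> R" "opair v w \<epsilon> R" for u v w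
    using tree that unfolding is_tree_def transp_on_def rel_UNIV by (meson mem_elts_iff)
  have iso: "\<alpha> \<epsilon> \<beta> \<longleftrightarrow> opair (y \<alpha>) (y \<beta>) \<epsilon> R" if "\<alpha> \<epsilon> \<kappa>" "\<beta> \<epsilon> \<kappa>" for \<alpha> \<beta>
    using ordinal_total[OF ord that] y_less[OF that] y_less[OF that(2,1)] irrefl yT trans that by metis
  have inj: "inj_on y (elts \<kappa>)"
  proof (rule inj_onI)
    fix \<alpha> \<beta> assume *: "\<alpha> \<in> elts \<kappa>" "\<beta> \<in> elts \<kappa>" "y \<alpha> = y \<beta>"
    then show "\<alpha> = \<beta>"
      using ordinal_total[OF ord, of \<alpha> \<beta>] iso[of \<alpha> \<beta>] iso[of \<beta> \<alpha>] irrefl[OF yT, of \<alpha>] by auto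
  qed
  obtain D where D: "is_set D" "elts D = y ` elts \<kappa>"
    using small_image[OF small_elts y_definable, of \<kappa>] by (auto simp: small_def)
  let ?g = "lam \<kappa> y"
  have g: "is_function UNIV ?g (elts \<kappa>) (elts D)"
    by (rule is_function_lam[OF y_definable]) (simp add: D(2))
  have appl_g: "appl ?g \<beta> = y \<beta>" if "\<beta> \<in> elts \<kappa>" for \<beta>
    using appl_lam[OF y_definable] that by simp
  have "bij_betw (app UNIV ?g) (elts \<kappa>) (elts D)"
    using inj D(2) app_eq_appl[OF g] appl_g
      bij_betw_cong[of "elts \<kappa>" "app UNIV ?g" y "elts D"] by (simp add: bij_betw_def)
  then have bij: "is_bijection UNIV ?g (elts \<kappa>) (elts D)"
    using g by (simp add: is_bijection_def)
  obtain L' where L': "L' \<epsilon> \<F>" "\<And>\<pi> u. \<pi> \<epsilon> L' \<Longrightarrow> (\<And>h. h \<epsilon> L \<Longrightarrow> act h u = u) \<Longrightarrow>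
      act \<pi> (act \<tau> u) = act \<tau> u"
    using filter_conjugate[OF L \<tau>] by blast
  \<comment> \<open>\<open>L\<close> fixes the objects before \<open>\<tau>\<close> is applied, so
    its conjugate by \<open>\<tau>\<close> fixes the new chain pointwise.\<close>
  have fix_y: "act \<pi> (y \<beta>) = y \<beta>" if "\<pi> \<epsilon> L'" "\<beta> \<epsilon> \<kappa>" for \<pi> \<beta>
    unfolding y[OF that(2)]
    by (rule L'(2)[OF that(1)]) (use stable that(2) in simp)
  have \<kappa>M: "\<kappa> \<in> M" by (rule ordinal_HS[OF ord])
  have fix_g: "act \<pi> (appl ?g \<beta>) = appl ?g \<beta>" if "\<pi> \<epsilon> L'" "\<beta> \<epsilon> \<kappa>" for \<pi> \<beta>
    using fix_y[OF that] appl_g[of \<beta>] that(2) by simp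
  have g_mem: "appl ?g \<beta> \<in> M" if "\<beta> \<epsilon> \<kappa>" for \<beta>
    using HS_mem[OF T yT[OF that]] appl_g[of \<beta>] that by simp
  have "elts D = appl ?g ` elts \<kappa>"
    unfolding D(2) by (rule image_cong) (simp_all add: appl_g)
  then have gM: "?g \<in> M" and DM: "D \<in> M"
    using function_HS[OF g ord disjI1[OF refl] L'(1) fix_g g_mem] D(1) by blast+
  have "totalp_on (y ` elts \<kappa>) (rel UNIV R)"
  proof (rule totalp_onI, elim imageE)
    fix u v \<alpha> \<beta> assume *: "u \<noteq> v" "u = y \<alpha>" "v = y \<beta>" "\<alpha> \<in> elts \<kappa>" "\<beta> \<in> elts \<kappa>"
    then have "\<alpha> \<epsilon> \<beta> \<or> \<beta> \<epsilon> \<alpha>" using ordinal_total[OF ord, of \<alpha> \<beta>] by auto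
    then show "rel UNIV R u v \<or> rel UNIV R v u" using * y_less by auto
  qed
  then have "is_chain UNIV T R D"
    using D yT by (auto simp: is_chain_def)
  then have "is_chain M T R D" using is_chain_HS[OF T DM] by simp
  moreover have "has_order_type M R D \<kappa>"
    by (rule has_order_type_HS[OF gM DM \<kappa>M bij]) (use iso appl_g in simp)
  ultimately show ?thesis using that DM by blast
qed

end

theorem theorem8:
  fixes \<G> \<F> \<kappa> :: "'v::zfa"
  assumes "permutation_group \<G>"
    and "normal_filter \<F> \<G>"
    and "infinite_cardinal \<kappa>"
    and "DC UNIV \<kappa>"
    and "shift_complete \<G> \<F> (osucc \<kappa>)"
  shows "DC (HS \<G> \<F>) \<kappa>"
proof -
  interpret permutation_model \<G> \<F>
    using assms by unfold_locales
  have ord: "ordinal \<kappa>" using assms(3) by (simp add: infinite_cardinal_def)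
  show ?thesis
    unfolding DC_def
  proof (intro ballI impI, elim conjE)
    fix T R assume TR: "T \<in> M" "R \<in> M" and tree: "is_tree M T R" and closed: "closed_tree M \<kappa> T R"
    have tree': "is_tree UNIV T R" by (rule is_tree_UNIV[OF TR tree])
    have "closed_tree UNIV \<kappa> T R" by (rule closed_tree_UNIV[OF assms(5) ord TR(1) closed])
    with tree' assms(4) consider
      C where "is_chain UNIV T R C" "has_order_type UNIV R C \<kappa>"
      | t where "t \<epsilon> T" "\<And>s. s \<epsilon> T \<Longrightarrow> \<not> rel UNIV R t s"
      unfolding DC_def by (metis UNIV_I mem_elts_iff)
    then show "(\<exists>C\<in>M. is_chain M T R C \<and> has_order_type M R C \<kappa>) \<or>
        (\<exists>t\<in>elts_in M T. \<forall>s\<in>elts_in M T. \<not> rel M R t s)"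
    proof cases
      case 1
      then obtain D where "D \<in> M" "is_chain M T R D" "has_order_type M R D \<kappa>"
        using chain_HS[OF assms(5,3) TR tree'] by blast
      then show ?thesis by blast
    next
      case 2
      \<comment> \<open>The tree order is absolute on elements of \<open>T\<close>, so a maximal
        element of the universe is maximal in the model.\<close>
      then have "\<not> rel M R t s" if "s \<epsilon> T" for s
        using that HS_mem[OF TR(1)] rel_HS by simp
      with \<open>t \<epsilon> T\<close> show ?thesis
        by (intro disjI2 bexI[of _ t]) (simp_all add: elts_HS[OF TR(1)])
    qed
  qed
qed

end
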